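(* Let $\mathbf{k}$ be a field, $\lambda\in\mathbf{k}$, let $(\mathfrak{g},P_{\mathfrak{g}})$ be a Rota-Baxter Lie algebra of weight $\lambda$ with $\mathfrak{g}$ a subspace of codimension $1$ in a vector space $E$, and let $V$ be a complement of $\mathfrak{g}$ in $E$ with basis $\{x\}$. Then the relation $\equiv$ on the set $ExDer((\mathfrak{g},P_{\mathfrak{g}}))$ of all extended derivations of $(\mathfrak{g},P_{\mathfrak{g}})$ (defined in the context) is an equivalence relation, and there are bijections $$Extd(E,(\mathfrak{g},P_{\mathfrak{g}}))\cong H^2_{(\mathfrak{g},P_{\mathfrak{g}})}(V,(\mathfrak{g},P_{\mathfrak{g}}))\cong ExDer((\mathfrak{g},P_{\mathfrak{g}}))/\equiv .$$ Here the first bijection sends the class of a Rota-Baxter Lie extending structure to the class of its unified product $\mathfrak{g}\natural V$ (transported to $E$ along $(g,y)\mapsto g+y$), read from $H^2_{(\mathfrak{g},P_{\mathfrak{g}})}(V,(\mathfrak{g},P_{\mathfrak{g}}))$ to $Extd(E,(\mathfrak{g},P_{\mathfrak{g}}))$, and the second is induced by sending an extended derivation $(\varepsilon,D,g_0,k_0)$ to the extending structure determined by $x\triangleleft g=\varepsilon(g)x$, $x\triangleright g=D(g)$, $f=0$, $\{-,-\}=0$, $P_1(x)=g_0$, $P_2(x)=k_0x$ ($g\in\mathfrak{g}$).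
   Context: All vector spaces, linear and bilinear maps are over the field $\mathbf{k}$; $\lambda\in\mathbf{k}$ is fixed. A Rota-Baxter Lie algebra (of weight $\lambda$) is a Lie algebra $\mathfrak{g}$ with a linear map $P:\mathfrak{g}\to\mathfrak{g}$ such that $[P(g),P(h)]=P([P(g),h]+[g,P(h)]+\lambda[g,h])$ for all $g,h\in\mathfrak{g}$. A morphism $(\mathfrak{g},P)\to(\mathfrak{g}',P')$ is a Lie algebra morphism $\phi$ with $\phi\circ P=P'\circ\phi$; it is an isomorphism if it is bijective. $(\mathfrak{g},P_{\mathfrak{g}})$ is a Rota-Baxter Lie subalgebra of $(E,[-,-],P_E)$ if $\mathfrak{g}\subseteq E$ is a subspace, the bracket of $E$ restricts to that of $\mathfrak{g}$, and $P_E|_{\mathfrak{g}}=P_{\mathfrak{g}}$. A complement of $\mathfrak{g}$ in $E$ is a subspace $V$ with $E=\mathfrak{g}+V$, $\mathfrak{g}\cap V=0$. $Extd(E,(\mathfrak{g},P_{\mathfrak{g}}))$: the set of equivalence classes of Rota-Baxter Lie algebra structures $([-,-],P)$ on $E$ containing $(\mathfrak{g},P_{\mathfrak{g}})$ as a Rota-Baxter Lie subalgebra, where two structures are equivalent if there is an isomorphism of Rota-Baxter Lie algebras $\phi:(E,[-,-],P)\to(E,[-,-]',P')$ with $\phi(g)=g$ for all $g\in\mathfrak{g}$. Extending datum: a system $(\triangleleft,\triangleright,f,\{-,-\},P_1,P_2)$ of bilinear maps $\triangleleft:V\times\mathfrak{g}\to V$, $\triangleright:V\times\mathfrak{g}\to\mathfrak{g}$,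 $f:V\times V\to\mathfrak{g}$, $\{-,-\}:V\times V\to V$ and linear maps $P_1:V\to\mathfrak{g}$, $P_2:V\to V$. Given such a datum, $\mathfrak{g}\natural V$ denotes the vector space $\mathfrak{g}\times V$ with $$[(g,y),(h,z)]:=([g,h]+y\triangleright h-z\triangleright g+f(y,z),\ \{y,z\}+y\triangleleft h-z\triangleleft g),\quad \mathcal{P}((g,y)):=(P_{\mathfrak{g}}(g)+P_1(y),\ P_2(y)).$$ The datum is a Rota-Baxter Lie extending structure if $\mathfrak{g}\natural V$ with these maps is a Rota-Baxter Lie algebra of weight $\lambda$ (the unified product). $\mathcal{L}((\mathfrak{g},P_{\mathfrak{g}}),V)$ is the set of all of them. $H^2_{(\mathfrak{g},P_{\mathfrak{g}})}(V,(\mathfrak{g},P_{\mathfrak{g}}))$ is the quotient of $\mathcal{L}((\mathfrak{g},P_{\mathfrak{g}}),V)$ by the equivalence relation: $(\triangleleft,\triangleright,f,\{-,-\},P_1,P_2)\equiv(\triangleleft',\triangleright',f',\{-,-\}',P_1',P_2')$ if there exist a linear map $r:V\to\mathfrak{g}$ and a linear automorphism $v$ of $V$ such that for all $g\in\mathfrak{g}$, $y,z\in V$, writing $\bar y=v^{-1}(y)$, $\bar z=v^{-1}(z)$: $y\triangleleft' g=v(\bar y\triangleleft g)$; $y\triangleright' g=r(\bar y\triangleleft g)+\bar y\triangleright g+[g,r(\bar y)]$; $f'(y,z)=f(\bar y,\bar z)+r(\{\bar y,\bar z\})+[r(\bar y),r(\bar z)]-r(\bar y\triangleleft r(\bar z))-\bar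 y\triangleright r(\bar z)+r(\bar z\triangleleft r(\bar y))+\bar z\triangleright r(\bar y)$; $\{y,z\}'=v(\{\bar y,\bar z\})-v(\bar y\triangleleft r(\bar z))+v(\bar z\triangleleft r(\bar y))$; $P_1'(y)=P_1(\bar y)-P_{\mathfrak{g}}(r(\bar y))+r(P_2(\bar y))$; $P_2'(y)=v(P_2(\bar y))$. Extended derivation of $(\mathfrak{g},P_{\mathfrak{g}})$: a quadruple $(\varepsilon,D,g_0,k_0)$ with $\varepsilon:\mathfrak{g}\to\mathbf{k}$, $D:\mathfrak{g}\to\mathfrak{g}$ linear, $g_0\in\mathfrak{g}$, $k_0\in\mathbf{k}$, such that for all $g,h\in\mathfrak{g}$: $\varepsilon([g,h])=0$; $D([g,h])=[D(g),h]+[g,D(h)]+\varepsilon(g)D(h)-\varepsilon(h)D(g)$; $[P_{\mathfrak{g}}(g),g_0]-k_0D(P_{\mathfrak{g}}(g))+P_{\mathfrak{g}}(D(P_{\mathfrak{g}}(g)))+\varepsilon(P_{\mathfrak{g}}(g))g_0-P_{\mathfrak{g}}([g,g_0])+P_{\mathfrak{g}}(k_0D(g))+k_0\varepsilon(g)g_0+\lambda P_{\mathfrak{g}}(D(g))+\lambda\varepsilon(g)g_0=0$; $k_0^2\varepsilon(g)+\lambda k_0\varepsilon(g)=0$. Relation $\equiv$ on $ExDer((\mathfrak{g},P_{\mathfrak{g}}))$: $(\varepsilon,D,g_0,k_0)\equiv(\varepsilon',D',g_0',k_0')$ if $\varepsilon=\varepsilon'$, $k_0=k_0'$, and there exist $g_1\in\mathfrak{g}$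 and a nonzero $k_1\in\mathbf{k}$ such that $D(g)=k_1D'(g)+[g_1,g]-\varepsilon(g)g_1$ for all $g\in\mathfrak{g}$, and $g_0=P_{\mathfrak{g}}(g_1)+k_1g_0'-k_0g_1$. *)

theory Defs
  imports "HOL-Analysis.Product_Vector" "HOL-Library.FuncSet"
begin

(* Vector spaces are subspaces (carrier sets) of a type equipped with a scalar multiplication
   satisfying the locale vector_space. *)

section \<open>Linear and bilinear maps between subspaces\<close>

(* The two scalar multiplications may differ, so that linear forms into the field
   (with multiplication as scaling) are covered. *)
definition linear_on ::
  "('k::field \<Rightarrow> 'a::ab_group_add \<Rightarrow> 'a) \<Rightarrow> ('k \<Rightarrow> 'b::ab_group_add \<Rightarrow> 'b) \<Rightarrow> 'a set \<Rightarrow> 'b set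
    \<Rightarrow> ('a \<Rightarrow> 'b) \<Rightarrow> bool"
  where "linear_on s1 s2 S T f \<longleftrightarrow>
    f \<in> S \<rightarrow> T \<and>
    (\<forall>x\<in>S. \<forall>y\<in>S. f (x + y) = f x + f y) \<and>
    (\<forall>c. \<forall>x\<in>S. f (s1 c x) = s2 c (f x))"

definition bilinear_on ::
  "('k::field \<Rightarrow> 'a::ab_group_add \<Rightarrow> 'a) \<Rightarrow> 'a set \<Rightarrow> 'a set \<Rightarrow> 'a set \<Rightarrow> ('a \<Rightarrow> 'a \<Rightarrow> 'a) \<Rightarrow> bool"
  where "bilinear_on s S T U f \<longleftrightarrow>
    (\<forall>x\<in>S. linear_on s s T U (f x)) \<and> (\<forall>y\<in>T. linear_on s s S U (\<lambda>x. f x y))"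

(* E is the whole type.  G has codimension n exactly when it has a complement of dimension n;
   codimension 1 is thus expressed by a complement with a one-element basis. *)
definition complement_of ::
  "('k::field \<Rightarrow> 'e::ab_group_add \<Rightarrow> 'e) \<Rightarrow> 'e set \<Rightarrow> 'e set \<Rightarrow> bool"
  where "complement_of s G V \<longleftrightarrow>
    module.subspace s V \<and> {g + y |g y. g \<in> G \<and> y \<in> V} = UNIV \<and> G \<inter> V = {0}"

section \<open>Rota-Baxter Lie algebras\<close>

(* The bracket is alternating, not merely antisymmetric: the field may have characteristic 2. *)
locale lie_algebra_on = vector_space scale
  for scale :: "'k::field \<Rightarrow> 'a::ab_group_add \<Rightarrow> 'a" +
  fixes S :: "'a set" and br :: "'a \<Rightarrow> 'a \<Rightarrow> 'a"
  assumes carrier_subspace: "subspace S"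
    and bracket_bilinear: "bilinear_on scale S S S br"
    and bracket_alternating: "x \<in> S \<Longrightarrow> br x x = 0"
    and jacobi: "\<lbrakk>x \<in> S; y \<in> S; z \<in> S\<rbrakk> \<Longrightarrow> br x (br y z) + br y (br z x) + br z (br x y) = 0"

locale rota_baxter_lie_algebra_on = lie_algebra_on scale S br
  for scale :: "'k::field \<Rightarrow> 'a::ab_group_add \<Rightarrow> 'a" and S br +
  fixes lam :: 'k and P :: "'a \<Rightarrow> 'a"
  assumes operator_linear: "linear_on scale scale S S P"
    and rota_baxter: "\<lbrakk>g \<in> S; h \<in> S\<rbrakk> \<Longrightarrow>
      br (P g) (P h) = P (br (P g) h + br g (P h) + scale lam (br g h))"

definition rb_lie_morphism_on ::
  "('k::field \<Rightarrow> 'a::ab_group_add \<Rightarrow> 'a) \<Rightarrow> 'a set \<Rightarrow> ('a \<Rightarrow> 'a \<Rightarrow> 'a) \<Rightarrow> ('a \<Rightarrow> 'a)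
    \<Rightarrow> ('k \<Rightarrow> 'b::ab_group_add \<Rightarrow> 'b) \<Rightarrow> 'b set \<Rightarrow> ('b \<Rightarrow> 'b \<Rightarrow> 'b) \<Rightarrow> ('b \<Rightarrow> 'b)
    \<Rightarrow> ('a \<Rightarrow> 'b) \<Rightarrow> bool"
  where "rb_lie_morphism_on s S br P s' S' br' P' \<phi> \<longleftrightarrow>
    linear_on s s' S S' \<phi> \<and>
    (\<forall>g\<in>S. \<forall>h\<in>S. \<phi> (br g h) = br' (\<phi> g) (\<phi> h)) \<and>
    (\<forall>g\<in>S. \<phi> (P g) = P' (\<phi> g))"

definition rb_lie_isomorphism_on ::
  "('k::field \<Rightarrow> 'a::ab_group_add \<Rightarrow> 'a) \<Rightarrow> 'a set \<Rightarrow> ('a \<Rightarrow> 'a \<Rightarrow> 'a) \<Rightarrow> ('a \<Rightarrow> 'a)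
    \<Rightarrow> ('k \<Rightarrow> 'b::ab_group_add \<Rightarrow> 'b) \<Rightarrow> 'b set \<Rightarrow> ('b \<Rightarrow> 'b \<Rightarrow> 'b) \<Rightarrow> ('b \<Rightarrow> 'b)
    \<Rightarrow> ('a \<Rightarrow> 'b) \<Rightarrow> bool"
  where "rb_lie_isomorphism_on s S br P s' S' br' P' \<phi> \<longleftrightarrow>
    rb_lie_morphism_on s S br P s' S' br' P' \<phi> \<and> bij_betw \<phi> S S'"

definition rb_lie_subalgebra ::
  "('k::field \<Rightarrow> 'e::ab_group_add \<Rightarrow> 'e) \<Rightarrow> 'e set \<Rightarrow> ('e \<Rightarrow> 'e \<Rightarrow> 'e) \<Rightarrow> ('e \<Rightarrow> 'e)
    \<Rightarrow> ('e \<Rightarrow> 'e \<Rightarrow> 'e) \<Rightarrow> ('e \<Rightarrow> 'e) \<Rightarrow> bool"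
  where "rb_lie_subalgebra s G brg Pg brE PE \<longleftrightarrow>
    module.subspace s G \<and>
    (\<forall>g\<in>G. \<forall>h\<in>G. brE g h = brg g h) \<and> (\<forall>g\<in>G. PE g = Pg g)"

section \<open>The extending structures problem\<close>

(* E is the whole type, so brackets and operators on E are plain functions. *)
definition rb_structures ::
  "('k::field \<Rightarrow> 'e::ab_group_add \<Rightarrow> 'e) \<Rightarrow> 'k \<Rightarrow> 'e set \<Rightarrow> ('e \<Rightarrow> 'e \<Rightarrow> 'e) \<Rightarrow> ('e \<Rightarrow> 'e)
    \<Rightarrow> (('e \<Rightarrow> 'e \<Rightarrow> 'e) \<times> ('e \<Rightarrow> 'e)) set"
  where "rb_structures s lam G brg Pg =
    {(br, P). rota_baxter_lie_algebra_on s UNIV br lam P \<and> rb_lie_subalgebra s G brg Pg br P}"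

definition rb_structures_rel ::
  "('k::field \<Rightarrow> 'e::ab_group_add \<Rightarrow> 'e) \<Rightarrow> 'k \<Rightarrow> 'e set \<Rightarrow> ('e \<Rightarrow> 'e \<Rightarrow> 'e) \<Rightarrow> ('e \<Rightarrow> 'e)
    \<Rightarrow> ((('e \<Rightarrow> 'e \<Rightarrow> 'e) \<times> ('e \<Rightarrow> 'e)) \<times> (('e \<Rightarrow> 'e \<Rightarrow> 'e) \<times> ('e \<Rightarrow> 'e))) set"
  where "rb_structures_rel s lam G brg Pg =
    {((br, P), (br', P')).
      (br, P) \<in> rb_structures s lam G brg Pg \<and> (br', P') \<in> rb_structures s lam G brg Pg \<and>
      (\<exists>\<phi>. rb_lie_isomorphism_on s UNIV br P s UNIV br' P' \<phi> \<and> (\<forall>g\<in>G. \<phi> g = g))}"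

definition Extd ::
  "('k::field \<Rightarrow> 'e::ab_group_add \<Rightarrow> 'e) \<Rightarrow> 'k \<Rightarrow> 'e set \<Rightarrow> ('e \<Rightarrow> 'e \<Rightarrow> 'e) \<Rightarrow> ('e \<Rightarrow> 'e)
    \<Rightarrow> (('e \<Rightarrow> 'e \<Rightarrow> 'e) \<times> ('e \<Rightarrow> 'e)) set set"
  where "Extd s lam G brg Pg = rb_structures s lam G brg Pg // rb_structures_rel s lam G brg Pg"

section \<open>Extending data and unified products\<close>

(* ractV y g is the right action of g on y in V, lactG y g the left action of y on g. *)
record 'e extending_datum =
  ractV :: "'e \<Rightarrow> 'e \<Rightarrow> 'e"
  lactG :: "'e \<Rightarrow> 'e \<Rightarrow> 'e"
  cocyc :: "'e \<Rightarrow> 'e \<Rightarrow> 'e"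
  brV :: "'e \<Rightarrow> 'e \<Rightarrow> 'e"
  opP1 :: "'e \<Rightarrow> 'e"
  opP2 :: "'e \<Rightarrow> 'e"

(* Extensionality makes equality of data coincide with equality as maps on V and G. *)
definition extending_data ::
  "('k::field \<Rightarrow> 'e::ab_group_add \<Rightarrow> 'e) \<Rightarrow> 'e set \<Rightarrow> 'e set \<Rightarrow> 'e extending_datum set"
  where "extending_data s G V = {d.
    ractV d \<in> V \<rightarrow>\<^sub>E G \<rightarrow>\<^sub>E V \<and> bilinear_on s V G V (ractV d) \<and>
    lactG d \<in> V \<rightarrow>\<^sub>E G \<rightarrow>\<^sub>E G \<and> bilinear_on s V G G (lactG d) \<and>
    cocyc d \<in> V \<rightarrow>\<^sub>E V \<rightarrow>\<^sub>E G \<and> bilinear_on s V V G (cocyc d) \<and>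
    brV d \<in> V \<rightarrow>\<^sub>E V \<rightarrow>\<^sub>E V \<and> bilinear_on s V V V (brV d) \<and>
    opP1 d \<in> V \<rightarrow>\<^sub>E G \<and> linear_on s s V G (opP1 d) \<and>
    opP2 d \<in> V \<rightarrow>\<^sub>E V \<and> linear_on s s V V (opP2 d)}"

definition unified_bracket ::
  "('e::ab_group_add \<Rightarrow> 'e \<Rightarrow> 'e) \<Rightarrow> 'e extending_datum \<Rightarrow> 'e \<times> 'e \<Rightarrow> 'e \<times> 'e \<Rightarrow> 'e \<times> 'e"
  where "unified_bracket brg d = (\<lambda>(g, y) (h, z).
    (brg g h + lactG d y h - lactG d z g + cocyc d y z,
     brV d y z + ractV d y h - ractV d z g))"

definition unified_operator ::
  "('e::ab_group_add \<Rightarrow> 'e) \<Rightarrow> 'e extending_datum \<Rightarrow> 'e \<times> 'e \<Rightarrow> 'e \<times> 'e"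
  where "unified_operator Pg d = (\<lambda>(g, y). (Pg g + opP1 d y, opP2 d y))"

definition extending_structures ::
  "('k::field \<Rightarrow> 'e::ab_group_add \<Rightarrow> 'e) \<Rightarrow> 'k \<Rightarrow> 'e set \<Rightarrow> ('e \<Rightarrow> 'e \<Rightarrow> 'e) \<Rightarrow> ('e \<Rightarrow> 'e)
    \<Rightarrow> 'e set \<Rightarrow> 'e extending_datum set"
  where "extending_structures s lam G brg Pg V = {d \<in> extending_data s G V.
    rota_baxter_lie_algebra_on (module_prod.scale s s) (G \<times> V)
      (unified_bracket brg d) lam (unified_operator Pg d)}"

definition extending_structures_rel ::
  "('k::field \<Rightarrow> 'e::ab_group_add \<Rightarrow> 'e) \<Rightarrow> 'k \<Rightarrow> 'e set \<Rightarrow> ('e \<Rightarrow> 'e \<Rightarrow> 'e) \<Rightarrow> ('e \<Rightarrow> 'e)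
    \<Rightarrow> 'e set \<Rightarrow> ('e extending_datum \<times> 'e extending_datum) set"
  where "extending_structures_rel s lam G brg Pg V = {(d, d').
    d \<in> extending_structures s lam G brg Pg V \<and> d' \<in> extending_structures s lam G brg Pg V \<and>
    (\<exists>r v. linear_on s s V G r \<and> linear_on s s V V v \<and> bij_betw v V V \<and>
      (\<forall>g\<in>G. \<forall>y\<in>V. \<forall>z\<in>V. let y1 = inv_into V v y; z1 = inv_into V v z in
        ractV d' y g = v (ractV d y1 g) \<and>
        lactG d' y g = r (ractV d y1 g) + lactG d y1 g + brg g (r y1) \<and>
        cocyc d' y z = cocyc d y1 z1 + r (brV d y1 z1) + brg (r y1) (r z1)
          - r (ractV d y1 (r z1)) - lactG d y1 (r z1)
          + r (ractV d z1 (r y1)) + lactG d z1 (r y1) \<and>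
        brV d' y z = v (brV d y1 z1) - v (ractV d y1 (r z1)) + v (ractV d z1 (r y1)) \<and>
        opP1 d' y = opP1 d y1 - Pg (r y1) + r (opP2 d y1) \<and>
        opP2 d' y = v (opP2 d y1)))}"

definition H2 ::
  "('k::field \<Rightarrow> 'e::ab_group_add \<Rightarrow> 'e) \<Rightarrow> 'k \<Rightarrow> 'e set \<Rightarrow> ('e \<Rightarrow> 'e \<Rightarrow> 'e) \<Rightarrow> ('e \<Rightarrow> 'e)
    \<Rightarrow> 'e set \<Rightarrow> 'e extending_datum set set"
  where "H2 s lam G brg Pg V =
    extending_structures s lam G brg Pg V // extending_structures_rel s lam G brg Pg V"

(* The unified product transported to E along (g, y) |-> g + y, which is bijective
   from G x V to E when V is a complement of G. *)
definition transported_product ::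
  "'e set \<Rightarrow> ('e::ab_group_add \<Rightarrow> 'e \<Rightarrow> 'e) \<Rightarrow> ('e \<Rightarrow> 'e) \<Rightarrow> 'e set \<Rightarrow> 'e extending_datum
    \<Rightarrow> ('e \<Rightarrow> 'e \<Rightarrow> 'e) \<times> ('e \<Rightarrow> 'e)"
  where "transported_product G brg Pg V d =
    (let \<sigma> = (\<lambda>(g, y). g + y); \<tau> = inv_into (G \<times> V) \<sigma> in
      (\<lambda>a b. \<sigma> (unified_bracket brg d (\<tau> a) (\<tau> b)), \<lambda>a. \<sigma> (unified_operator Pg d (\<tau> a))))"

section \<open>Extended derivations\<close>

(* epsilon and D are extensional on G, for the same reason as in extending_data. *)
definition ExDer ::
  "('k::field \<Rightarrow> 'e::ab_group_add \<Rightarrow> 'e) \<Rightarrow> 'k \<Rightarrow> 'e set \<Rightarrow> ('e \<Rightarrow> 'e \<Rightarrow> 'e) \<Rightarrow> ('e \<Rightarrow> 'e)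
    \<Rightarrow> (('e \<Rightarrow> 'k) \<times> ('e \<Rightarrow> 'e) \<times> 'e \<times> 'k) set"
  where "ExDer s lam G brg Pg = {(\<epsilon>, D, g0, k0).
    \<epsilon> \<in> G \<rightarrow>\<^sub>E UNIV \<and> linear_on s (*) G UNIV \<epsilon> \<and>
    D \<in> G \<rightarrow>\<^sub>E G \<and> linear_on s s G G D \<and>
    g0 \<in> G \<and>
    (\<forall>g\<in>G. \<forall>h\<in>G. \<epsilon> (brg g h) = 0) \<and>
    (\<forall>g\<in>G. \<forall>h\<in>G. D (brg g h) = brg (D g) h + brg g (D h) + s (\<epsilon> g) (D h) - s (\<epsilon> h) (D g)) \<and>
    (\<forall>g\<in>G. brg (Pg g) g0 - s k0 (D (Pg g)) + Pg (D (Pg g)) + s (\<epsilon> (Pg g)) g0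
      - Pg (brg g g0) + Pg (s k0 (D g)) + s (k0 * \<epsilon> g) g0
      + s lam (Pg (D g)) + s (lam * \<epsilon> g) g0 = 0) \<and>
    (\<forall>g\<in>G. k0\<^sup>2 * \<epsilon> g + lam * k0 * \<epsilon> g = 0)}"

definition ExDer_rel ::
  "('k::field \<Rightarrow> 'e::ab_group_add \<Rightarrow> 'e) \<Rightarrow> 'k \<Rightarrow> 'e set \<Rightarrow> ('e \<Rightarrow> 'e \<Rightarrow> 'e) \<Rightarrow> ('e \<Rightarrow> 'e)
    \<Rightarrow> ((('e \<Rightarrow> 'k) \<times> ('e \<Rightarrow> 'e) \<times> 'e \<times> 'k) \<times> (('e \<Rightarrow> 'k) \<times> ('e \<Rightarrow> 'e) \<times> 'e \<times> 'k)) set"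
  where "ExDer_rel s lam G brg Pg = {((\<epsilon>, D, g0, k0), (\<epsilon>', D', g0', k0')).
    (\<epsilon>, D, g0, k0) \<in> ExDer s lam G brg Pg \<and> (\<epsilon>', D', g0', k0') \<in> ExDer s lam G brg Pg \<and>
    \<epsilon> = \<epsilon>' \<and> k0 = k0' \<and>
    (\<exists>g1\<in>G. \<exists>k1. k1 \<noteq> 0 \<and>
      (\<forall>g\<in>G. D g = s k1 (D' g) + brg g1 g - s (\<epsilon> g) g1) \<and>
      g0 = Pg g1 + s k1 g0' - s k0 g1)}"

(* representation {x} y x is the coordinate of y in V with respect to the basis {x}, so this is
   the extending datum obtained by (bi)linear extension from the values on the basis vector x. *)
definition exder_datum ::
  "('k::field \<Rightarrow> 'e::ab_group_add \<Rightarrow> 'e) \<Rightarrow> 'e set \<Rightarrow> 'e set \<Rightarrow> 'e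
    \<Rightarrow> ('e \<Rightarrow> 'k) \<times> ('e \<Rightarrow> 'e) \<times> 'e \<times> 'k \<Rightarrow> 'e extending_datum"
  where "exder_datum s G V x = (\<lambda>(\<epsilon>, D, g0, k0).
    let c = (\<lambda>y. module.representation s {x} y x) in
    \<lparr> ractV = (\<lambda>y\<in>V. \<lambda>g\<in>G. s (c y) (s (\<epsilon> g) x)),
      lactG = (\<lambda>y\<in>V. \<lambda>g\<in>G. s (c y) (D g)),
      cocyc = (\<lambda>y\<in>V. \<lambda>z\<in>V. 0),
      brV = (\<lambda>y\<in>V. \<lambda>z\<in>V. 0),
      opP1 = (\<lambda>y\<in>V. s (c y) g0),
      opP2 = (\<lambda>y\<in>V. s (c y) (s k0 x)) \<rparr>)"

lemma exder_datum_basis: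
  assumes "vector_space s" "\<not> module.dependent s {x}" "module.span s {x} = V"
  shows "x \<in> V"
    and "g \<in> G \<Longrightarrow> ractV (exder_datum s G V x (\<epsilon>, D, g0, k0)) x g = s (\<epsilon> g) x"
    and "g \<in> G \<Longrightarrow> lactG (exder_datum s G V x (\<epsilon>, D, g0, k0)) x g = D g"
    and "opP1 (exder_datum s G V x (\<epsilon>, D, g0, k0)) x = g0"
    and "opP2 (exder_datum s G V x (\<epsilon>, D, g0, k0)) x = s k0 x"
proof -
  interpret vector_space s by fact
  show x: "x \<in> V" using assms(3) span_base[of x "{x}"] by auto
  have "representation {x} x x = 1" using representation_basis[OF assms(2)] by simp
  with x show "g \<in> G \<Longrightarrow> ractV (exder_datum s G V x (\<epsilon>, D, g0, k0)) x g = s (\<epsilon> g) x"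
    and "g \<in> G \<Longrightarrow> lactG (exder_datum s G V x (\<epsilon>, D, g0, k0)) x g = D g"
    and "opP1 (exder_datum s G V x (\<epsilon>, D, g0, k0)) x = g0"
    and "opP2 (exder_datum s G V x (\<epsilon>, D, g0, k0)) x = s k0 x"
    by (simp_all add: exder_datum_def)
qed

lemma bij_betw_sum_complement:
  assumes "vector_space s" "module.subspace s G" "complement_of s G V"
  shows "bij_betw (\<lambda>(g, y). g + y) (G \<times> V) UNIV"
proof -
  interpret vector_space s by fact
  have V: "subspace V" "{g + y |g y. g \<in> G \<and> y \<in> V} = UNIV" "G \<inter> V = {0}"
    using assms(3) by (auto simp: complement_of_def)
  have "g = h \<and> y = z" if "g \<in> G" "h \<in> G" "y \<in> V" "z \<in> V" "g + y = h + z" for g h y z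
  proof -
    have e: "g - h = z - y" using that(5) by (metis add_diff_eq diff_add_eq diff_eq_eq add.commute)
    have "g - h \<in> G" "z - y \<in> V" using that assms(2) V(1) by (auto intro: subspace_diff)
    with e V(3) have "g - h = 0" by (metis IntI singletonD)
    with e show ?thesis by simp
  qed
  then have "inj_on (\<lambda>(g, y). g + y) (G \<times> V)" by (auto simp: inj_on_def)
  moreover have "(\<lambda>(g, y). g + y) ` (G \<times> V) = {g + y |g y. g \<in> G \<and> y \<in> V}" by auto
  ultimately show ?thesis using V(2) by (simp add: bij_betw_def)
qed

end

theory Submission
  imports Defs
begin

text \<open>
  Both relations in question are pullbacks of isomorphism over \<open>G\<close>. A structure on
  \<open>E = G \<oplus> V\<close> is the transport of the unified product given by its components, and a linear
  automorphism of \<open>E\<close> fixing \<open>G\<close> pointwise is a shear \<open>(g, y) \<mapsto> (g + r y, v y)\<close>; comparing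
  components of the morphism condition yields exactly the relation defining \<open>H\<^sup>2\<close>.
  If \<open>V\<close> is a line spanned by \<open>x\<close>, the alternating law forces \<open>f = 0\<close> and \<open>{-,-} = 0\<close>, so that
  an extending datum is a quadruple \<open>(\<epsilon>, D, g\<^sub>0, k\<^sub>0)\<close>. The Jacobi identity on \<open>x, g, h\<close> and
  the Rota-Baxter identity on \<open>g, x\<close> are the axioms of extended derivations, and with
  \<open>g\<^sub>1 = r x\<close>, \<open>v x = k\<^sub>1 x\<close> the relation on \<open>H\<^sup>2\<close> becomes the one on extended derivations.
\<close>

section \<open>Quotients by pulled back equivalence relations\<close>

text \<open>If \<open>R\<close> is the pullback of \<open>S\<close> along \<open>f\<close>, two
  \<open>R\<close>-classes agree iff the \<open>S\<close>-classes of the images agree, so the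
  induced map of quotients is well defined and injective. It is onto as soon as the image of
  \<open>f\<close> meets every \<open>S\<close>-class. That \<open>R\<close> is an equivalence comes
  along; both bijections and the equivalence claim on extended derivations are obtained this
  way.\<close>

lemma quotient_bij_pullback:
  assumes B: "equiv B S" and f: "f \<in> A \<rightarrow> B"
    and surj: "\<And>b. b \<in> B \<Longrightarrow> \<exists>a\<in>A. (f a, b) \<in> S"
    and R: "\<And>a a'. (a, a') \<in> R \<longleftrightarrow> a \<in> A \<and> a' \<in> A \<and> (f a, f a') \<in> S"
  shows "equiv A R"
    and "\<exists>F. bij_betw F (A // R) (B // S) \<and> (\<forall>a\<in>A. F (R `` {a}) = S `` {f a})"
proof -
  from B have reflS: "refl_on B S" and symS: "sym S" and transS: "trans S"
    by (simp_all add: equiv_def)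
  show A: "equiv A R"
  proof (rule equivI)
    show "R \<subseteq> A \<times> A" by (clarify, simp add: R)
    show "refl_on A R" using f reflS by (simp add: refl_on_def R Pi_iff)
    show "sym R" using symD[OF symS] by (simp add: sym_def R)
    show "trans R" unfolding trans_def R by (metis transD[OF transS])
  qed
  have classes: "R `` {a} = R `` {a'} \<longleftrightarrow> S `` {f a} = S `` {f a'}" if "a \<in> A" "a' \<in> A" for a a'
    using that f by (simp add: eq_equiv_class_iff[OF A] eq_equiv_class_iff[OF B] R Pi_iff)
  \<comment> \<open>\<open>F\<close> picks an arbitrary representative of the class;
    \<open>classes\<close> shows that the choice does not affect the value.\<close>
  define F where "F X = S `` {f (SOME a. a \<in> A \<and> X = R `` {a})}" for X
  have F: "F (R `` {a}) = S `` {f a}" if "a \<in> A" for a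
  proof -
    let ?a = "SOME a'. a' \<in> A \<and> R `` {a} = R `` {a'}"
    have "?a \<in> A \<and> R `` {a} = R `` {?a}"
      by (rule someI[where P = "\<lambda>a'. a' \<in> A \<and> R `` {a} = R `` {a'}" and x = a]) (simp add: that)
    with classes[of a ?a] that show ?thesis by (simp add: F_def)
  qed
  have "inj_on F (A // R)"
    by (rule inj_onI, elim quotientE) (simp add: F classes)
  moreover have "F ` (A // R) = B // S"
  proof
    show "F ` (A // R) \<subseteq> B // S" using f by (auto simp: F elim!: quotientE intro!: quotientI)
    show "B // S \<subseteq> F ` (A // R)"
    proof
      fix Y assume "Y \<in> B // S"
      then obtain b where b: "b \<in> B" "Y = S `` {b}" by (auto elim: quotientE)
      from surj[OF b(1)] obtain a where a: "a \<in> A" "(f a, b) \<in> S" by blast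
      have "Y = F (R `` {a})" using equiv_class_eq[OF B a(2)] b(2) a(1) by (simp add: F)
      then show "Y \<in> F ` (A // R)" using a(1) by (auto intro: quotientI)
    qed
  qed
  ultimately show "\<exists>F. bij_betw F (A // R) (B // S) \<and> (\<forall>a\<in>A. F (R `` {a}) = S `` {f a})"
    using F by (auto simp: bij_betw_def)
qed

section \<open>Linear maps and brackets on subspaces\<close>

lemma linear_onD:
  assumes "linear_on s1 s2 S T f"
  shows "x \<in> S \<Longrightarrow> f x \<in> T"
    and "x \<in> S \<Longrightarrow> y \<in> S \<Longrightarrow> f (x + y) = f x + f y"
    and "x \<in> S \<Longrightarrow> f (s1 c x) = s2 c (f x)"
  using assms by (auto simp: linear_on_def)

lemma linear_on_additive:
  assumes "linear_on s1 s2 S T f" "vector_space s1" "module.subspace s1 S"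
  shows "f 0 = 0"
    and "x \<in> S \<Longrightarrow> f (- x) = - f x"
    and "x \<in> S \<Longrightarrow> y \<in> S \<Longrightarrow> f (x - y) = f x - f y"
proof -
  interpret vector_space s1 by fact
  note f = linear_onD(2)[OF assms(1)]
  have "f (0 + 0) = f 0 + f 0" using f subspace_0[OF assms(3)] by blast
  then show 0: "f 0 = 0" by simp
  show minus: "f (- x) = - f x" if "x \<in> S" for x
    using f[OF that subspace_neg[OF assms(3) that]] 0 by (simp add: eq_neg_iff_add_eq_0 add.commute)
  show "f (x - y) = f x - f y" if "x \<in> S" "y \<in> S"
    using f[OF that(1) subspace_neg[OF assms(3) that(2)]] minus[OF that(2)] by simp
qed

lemma bilinear_onD:
  assumes "bilinear_on s S T U f"
  shows "x \<in> S \<Longrightarrow> y \<in> T \<Longrightarrow> f x y \<in> U"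
    and "x \<in> S \<Longrightarrow> x' \<in> S \<Longrightarrow> y \<in> T \<Longrightarrow> f (x + x') y = f x y + f x' y"
    and "x \<in> S \<Longrightarrow> y \<in> T \<Longrightarrow> y' \<in> T \<Longrightarrow> f x (y + y') = f x y + f x y'"
    and "x \<in> S \<Longrightarrow> y \<in> T \<Longrightarrow> f (s c x) y = s c (f x y)"
    and "x \<in> S \<Longrightarrow> y \<in> T \<Longrightarrow> f x (s c y) = s c (f x y)"
  using assms by (auto simp: linear_on_def bilinear_on_def)

lemma bilinear_on_additive:
  assumes "bilinear_on s S T U f" "vector_space s" "module.subspace s S" "module.subspace s T"
  shows "y \<in> T \<Longrightarrow> f 0 y = 0"
    and "x \<in> S \<Longrightarrow> f x 0 = 0"
    and "x \<in> S \<Longrightarrow> y \<in> T \<Longrightarrow> f (- x) y = - f x y"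
    and "x \<in> S \<Longrightarrow> y \<in> T \<Longrightarrow> f x (- y) = - f x y"
    and "x \<in> S \<Longrightarrow> x' \<in> S \<Longrightarrow> y \<in> T \<Longrightarrow> f (x - x') y = f x y - f x' y"
    and "x \<in> S \<Longrightarrow> y \<in> T \<Longrightarrow> y' \<in> T \<Longrightarrow> f x (y - y') = f x y - f x y'"
proof -
  have l: "x \<in> S \<Longrightarrow> linear_on s s T U (f x)" and r: "y \<in> T \<Longrightarrow> linear_on s s S U (\<lambda>x. f x y)" for x y
    using assms(1) by (auto simp: bilinear_on_def)
  show "y \<in> T \<Longrightarrow> f 0 y = 0"
    and "x \<in> S \<Longrightarrow> f x 0 = 0"
    and "x \<in> S \<Longrightarrow> y \<in> T \<Longrightarrow> f (- x) y = - f x y"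
    and "x \<in> S \<Longrightarrow> y \<in> T \<Longrightarrow> f x (- y) = - f x y"
    and "x \<in> S \<Longrightarrow> x' \<in> S \<Longrightarrow> y \<in> T \<Longrightarrow> f (x - x') y = f x y - f x' y"
    and "x \<in> S \<Longrightarrow> y \<in> T \<Longrightarrow> y' \<in> T \<Longrightarrow> f x (y - y') = f x y - f x y'"
    using linear_on_additive[OF l assms(2,4)] linear_on_additive[OF r assms(2,3)] by auto
qed

lemma bilinear_onI:
  assumes "\<And>x y. x \<in> S \<Longrightarrow> y \<in> T \<Longrightarrow> f x y \<in> U"
    and "\<And>x x' y. x \<in> S \<Longrightarrow> x' \<in> S \<Longrightarrow> y \<in> T \<Longrightarrow> f (x + x') y = f x y + f x' y"
    and "\<And>x y y'. x \<in> S \<Longrightarrow> y \<in> T \<Longrightarrow> y' \<in> T \<Longrightarrow> f x (y + y') = f x y + f x y'"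
    and "\<And>c x y. x \<in> S \<Longrightarrow> y \<in> T \<Longrightarrow> f (s c x) y = s c (f x y)"
    and "\<And>c x y. x \<in> S \<Longrightarrow> y \<in> T \<Longrightarrow> f x (s c y) = s c (f x y)"
  shows "bilinear_on s S T U f"
  using assms by (auto simp: linear_on_def bilinear_on_def)

lemma linear_on_inv_into:
  assumes s: "vector_space s1" "module.subspace s1 S"
    and f: "linear_on s1 s2 S T f" and bij: "bij_betw f S T"
  shows "linear_on s2 s1 T S (inv_into S f)"
proof -
  interpret vector_space s1 by fact
  have inv: "inv_into S f (f x) = x" if "x \<in> S" for x
    using bij that by (simp add: bij_betw_inv_into_left)
  have img: "T = f ` S" using bij by (simp add: bij_betw_def)
  have add: "inv_into S f (f x + f y) = x + y" if "x \<in> S" "y \<in> S" for x y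
    using inv[of "x + y"] subspace_add[OF s(2) that] linear_onD(2)[OF f that] by simp
  have scale: "inv_into S f (s2 c (f x)) = s1 c x" if "x \<in> S" for x c
    using inv[of "s1 c x"] subspace_scale[OF s(2) that] linear_onD(3)[OF f that] by simp
  show ?thesis unfolding linear_on_def img by (auto simp: inv add scale)
qed

text \<open>Every element of \<open>T\<close> is a value of \<open>f\<close>, so each axiom on
  \<open>T\<close> is the image under \<open>f\<close> of the same axiom on \<open>S\<close>. It is
  applied in both directions: from \<open>G \<times> V\<close> to E along the sum map, and back
  along its inverse.\<close>

lemma rb_lie_algebra_transport:
  assumes rb: "rota_baxter_lie_algebra_on s1 S br lam P"
    and s2: "vector_space s2"
    and f: "linear_on s1 s2 S T f" and bij: "bij_betw f S T"
    and br': "\<And>a b. a \<in> S \<Longrightarrow> b \<in> S \<Longrightarrow> br' (f a) (f b) = f (br a b)"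
    and P': "\<And>a. a \<in> S \<Longrightarrow> P' (f a) = f (P a)"
  shows "rota_baxter_lie_algebra_on s2 T br' lam P'"
proof -
  interpret rota_baxter_lie_algebra_on s1 S br lam P by fact
  interpret s2: vector_space s2 by fact
  note S = carrier_subspace
  note b = bilinear_onD[OF bracket_bilinear]
  note p = linear_onD[OF operator_linear]
  note fl = linear_onD[OF f]
  have T: "T = f ` S" using bij by (simp add: bij_betw_def)
  have closed: "a + b \<in> S" "s1 c a \<in> S" if "a \<in> S" "b \<in> S" for a b c
    using that S by (auto intro: subspace_add subspace_scale)
  have f0: "f 0 = 0" using linear_on_additive(1)[OF f vector_space_axioms S] .
  \<comment> \<open>Oriented so that sums and multiples of values of \<open>f\<close> merge into one
    value of \<open>f\<close>, to which the hypotheses on \<open>br'\<close> and \<open>P'\<close>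
    then apply.\<close>
  have add: "f a + f b = f (a + b)" if "a \<in> S" "b \<in> S" for a b using fl(2)[OF that] by simp
  have scale: "s2 c (f a) = f (s1 c a)" if "a \<in> S" for c a using fl(3)[OF that] by simp
  have bil: "bilinear_on s2 T T T br'"
    unfolding T by (rule bilinear_onI) (auto simp: br' add scale b closed)
  have lin: "linear_on s2 s2 T T P'"
    unfolding T linear_on_def by (auto simp: P' p add scale closed)
  have sub: "s2.subspace T"
    unfolding T s2.subspace_def
  proof (intro conjI ballI allI)
    show "0 \<in> f ` S" using f0 subspace_0[OF S] by (metis imageI)
  qed (auto simp: add scale closed)
  show ?thesis
  proof (unfold_locales)
    show "s2.subspace T" by (fact sub)
    show "bilinear_on s2 T T T br'" by (fact bil)
    show "br' t t = 0" if "t \<in> T" for t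
      using that f0 by (auto simp: T br' bracket_alternating)
    show "br' t (br' u w) + br' u (br' w t) + br' w (br' t u) = 0"
      if "t \<in> T" "u \<in> T" "w \<in> T" for t u w
      using that f0 by (auto simp: T br' b add closed jacobi)
    show "linear_on s2 s2 T T P'" by (fact lin)
    show "br' (P' g) (P' h) = P' (br' (P' g) h + br' g (P' h) + s2 lam (br' g h))"
      if "g \<in> T" "h \<in> T" for g h
      using that by (auto simp: T br' P' b p add scale closed rota_baxter)
  qed
qed

section \<open>Isomorphisms\<close>

lemma rb_lie_isomorphism_id:
  "rb_lie_isomorphism_on s UNIV br P s UNIV br P id"
  by (simp add: rb_lie_isomorphism_on_def rb_lie_morphism_on_def linear_on_def)

lemma rb_lie_isomorphism_comp:
  assumes "rb_lie_isomorphism_on s1 S1 br1 P1 s2 S2 br2 P2 f"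
    and "rb_lie_isomorphism_on s2 S2 br2 P2 s3 S3 br3 P3 g"
  shows "rb_lie_isomorphism_on s1 S1 br1 P1 s3 S3 br3 P3 (g \<circ> f)"
  using assms bij_betw_trans[of f S1 S2 g S3]
  by (auto simp: rb_lie_isomorphism_on_def rb_lie_morphism_on_def linear_on_def Pi_iff)

text \<open>\<open>inv_into S1 f\<close> cancels \<open>f\<close> only on \<open>S1\<close>; the
  Rota-Baxter structure on the source supplies closure of \<open>S1\<close> under bracket and
  operator.\<close>

lemma rb_lie_isomorphism_inv:
  assumes rb: "rota_baxter_lie_algebra_on s1 S1 br1 lam P1"
    and f: "rb_lie_isomorphism_on s1 S1 br1 P1 s2 S2 br2 P2 f"
  shows "rb_lie_isomorphism_on s2 S2 br2 P2 s1 S1 br1 P1 (inv_into S1 f)"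
proof -
  interpret rota_baxter_lie_algebra_on s1 S1 br1 lam P1 by fact
  have bij: "bij_betw f S1 S2" and lin: "linear_on s1 s2 S1 S2 f"
    and br: "\<And>g h. g \<in> S1 \<Longrightarrow> h \<in> S1 \<Longrightarrow> br2 (f g) (f h) = f (br1 g h)"
    and P: "\<And>g. g \<in> S1 \<Longrightarrow> P2 (f g) = f (P1 g)"
    using f by (auto simp: rb_lie_isomorphism_on_def rb_lie_morphism_on_def)
  have inv: "inv_into S1 f (f g) = g" if "g \<in> S1" for g
    using bij that by (simp add: bij_betw_inv_into_left)
  have img: "S2 = f ` S1" using bij by (simp add: bij_betw_def)
  show ?thesis
    unfolding rb_lie_isomorphism_on_def rb_lie_morphism_on_def
    using linear_on_inv_into[OF vector_space_axioms carrier_subspace lin bij]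
      bij_betw_inv_into[OF bij] bilinear_onD(1)[OF bracket_bilinear] linear_onD(1)[OF operator_linear]
    by (auto simp: img br P inv)
qed

text \<open>Identities, composites and inverses of isomorphisms are isomorphisms, and fixing
  \<open>G\<close> pointwise passes to all three. This is the base relation from which the other two
  are pulled back.\<close>

lemma equiv_rb_structures_rel:
  "equiv (rb_structures s lam G brg Pg) (rb_structures_rel s lam G brg Pg)"
proof (rule equivI)
  show "rb_structures_rel s lam G brg Pg
      \<subseteq> rb_structures s lam G brg Pg \<times> rb_structures s lam G brg Pg"
    by (auto simp: rb_structures_rel_def)
  show "refl_on (rb_structures s lam G brg Pg) (rb_structures_rel s lam G brg Pg)"
    unfolding refl_on_def
  proof (clarify)
    fix br P assume "(br, P) \<in> rb_structures s lam G brg Pg"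
    moreover have "\<exists>f. rb_lie_isomorphism_on s UNIV br P s UNIV br P f \<and> (\<forall>x\<in>G. f x = x)"
      using rb_lie_isomorphism_id by (intro exI[of _ id]) simp
    ultimately show "((br, P), (br, P)) \<in> rb_structures_rel s lam G brg Pg"
      by (simp add: rb_structures_rel_def)
  qed
  show "trans (rb_structures_rel s lam G brg Pg)"
    unfolding trans_def
  proof (clarify)
    fix br P br' P' br'' P''
    assume 1: "((br, P), (br', P')) \<in> rb_structures_rel s lam G brg Pg"
      and 2: "((br', P'), (br'', P'')) \<in> rb_structures_rel s lam G brg Pg"
    then obtain f g where
      "rb_lie_isomorphism_on s UNIV br P s UNIV br' P' f" "\<forall>x\<in>G. f x = x"
      "rb_lie_isomorphism_on s UNIV br' P' s UNIV br'' P'' g" "\<forall>x\<in>G. g x = x"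
      by (auto simp: rb_structures_rel_def)
    then have "rb_lie_isomorphism_on s UNIV br P s UNIV br'' P'' (g \<circ> f)" "\<forall>x\<in>G. (g \<circ> f) x = x"
      by (auto intro: rb_lie_isomorphism_comp)
    with 1 2 show "((br, P), (br'', P'')) \<in> rb_structures_rel s lam G brg Pg"
      by (auto simp: rb_structures_rel_def)
  qed
  show "sym (rb_structures_rel s lam G brg Pg)"
    unfolding sym_def
  proof (clarify)
    fix br P br' P'
    assume 1: "((br, P), (br', P')) \<in> rb_structures_rel s lam G brg Pg"
    then obtain f where f: "rb_lie_isomorphism_on s UNIV br P s UNIV br' P' f" "\<forall>x\<in>G. f x = x"
      by (auto simp: rb_structures_rel_def)
    have "rota_baxter_lie_algebra_on s UNIV br lam P"
      using 1 by (auto simp: rb_structures_rel_def rb_structures_def)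
    from rb_lie_isomorphism_inv[OF this f(1)]
    have "rb_lie_isomorphism_on s UNIV br' P' s UNIV br P (inv f)" .
    moreover have "inj f" using f(1) by (auto simp: rb_lie_isomorphism_on_def bij_betw_def)
    then have "\<forall>x\<in>G. inv f x = x" using f(2) by (metis inv_f_f)
    ultimately show "((br', P'), (br, P)) \<in> rb_structures_rel s lam G brg Pg"
      using 1 by (auto simp: rb_structures_rel_def)
  qed
qed

section \<open>Unified products and structures on the ambient space\<close>

text \<open>Polarization: expand the alternating law at \<open>x + y\<close>. This is valid in every
  characteristic.\<close>

lemma (in lie_algebra_on) bracket_antisym:
  assumes x: "x \<in> S" and y: "y \<in> S" shows "br x y = - br y x"
proof -
  note b = bilinear_onD(2,3)[OF bracket_bilinear]
  have xy: "x + y \<in> S" using x y carrier_subspace by (auto intro: subspace_add)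
  have "br (x + y) (x + y) = br x y + br y x"
    using x y xy by (simp add: b bracket_alternating[OF x] bracket_alternating[OF y])
  then show ?thesis by (simp add: bracket_alternating[OF xy] eq_neg_iff_add_eq_0)
qed

text \<open>The complement may have any dimension here: the bijection between \<open>H2\<close> and
  \<open>Extd\<close> is proved in this generality.\<close>

locale rb_complement = rota_baxter_lie_algebra_on scale G brg lam Pg
  for scale :: "'k::field \<Rightarrow> 'e::ab_group_add \<Rightarrow> 'e" and G brg lam Pg +
  fixes V :: "'e set"
  assumes complement: "complement_of scale G V"
begin

abbreviation "data \<equiv> extending_data scale G V"
abbreviation "ext_structs \<equiv> extending_structures scale lam G brg Pg V"
abbreviation "ext_structs_rel \<equiv> extending_structures_rel scale lam G brg Pg V"
abbreviation "structs \<equiv> rb_structures scale lam G brg Pg"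
abbreviation "structs_rel \<equiv> rb_structures_rel scale lam G brg Pg"
abbreviation "prod_scale \<equiv> module_prod.scale scale scale"
abbreviation "ubr \<equiv> unified_bracket brg"
abbreviation "uop \<equiv> unified_operator Pg"
abbreviation "to_E \<equiv> transported_product G brg Pg V"

section \<open>Decomposition of E along G and V\<close>

definition sm :: "'e \<times> 'e \<Rightarrow> 'e" where "sm = (\<lambda>(g, y). g + y)"
text \<open>\<open>sm\<close> and \<open>decomp\<close> are the \<sigma> and \<tau> inside
  \<open>transported_product\<close>, so that \<open>to_E\<close> unfolds to conjugation by
  \<open>sm\<close>.\<close>

definition decomp :: "'e \<Rightarrow> 'e \<times> 'e" where "decomp = inv_into (G \<times> V) sm"
definition prG :: "'e \<Rightarrow> 'e" where "prG a = fst (decomp a)"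
definition prV :: "'e \<Rightarrow> 'e" where "prV a = snd (decomp a)"

lemma G_mem [simp]:
  "0 \<in> G" "a \<in> G \<Longrightarrow> b \<in> G \<Longrightarrow> a + b \<in> G" "a \<in> G \<Longrightarrow> b \<in> G \<Longrightarrow> a - b \<in> G"
  "a \<in> G \<Longrightarrow> - a \<in> G" "a \<in> G \<Longrightarrow> scale c a \<in> G"
  "a \<in> G \<Longrightarrow> b \<in> G \<Longrightarrow> brg a b \<in> G" "a \<in> G \<Longrightarrow> Pg a \<in> G"
  using carrier_subspace bilinear_onD(1)[OF bracket_bilinear] linear_onD(1)[OF operator_linear]
  by (auto intro: subspace_0 subspace_add subspace_diff subspace_neg subspace_scale)

lemma V_subspace: "subspace V"
  using complement by (simp add: complement_of_def)

lemma V_mem [simp]: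
  "0 \<in> V" "a \<in> V \<Longrightarrow> b \<in> V \<Longrightarrow> a + b \<in> V" "a \<in> V \<Longrightarrow> b \<in> V \<Longrightarrow> a - b \<in> V"
  "a \<in> V \<Longrightarrow> - a \<in> V" "a \<in> V \<Longrightarrow> scale c a \<in> V"
  using V_subspace
  by (auto intro: subspace_0 subspace_add subspace_diff subspace_neg subspace_scale)

lemmas bracket_simps =
  bilinear_onD(2-5)[OF bracket_bilinear]
  bilinear_on_additive[OF bracket_bilinear vector_space_axioms carrier_subspace carrier_subspace]

lemmas operator_simps =
  linear_onD(2,3)[OF operator_linear]
  linear_on_additive[OF operator_linear vector_space_axioms carrier_subspace]

lemma sm_bij: "bij_betw sm (G \<times> V) UNIV"
  unfolding sm_def by (rule bij_betw_sum_complement[OF vector_space_axioms carrier_subspace complement])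

lemma sm_pair [simp]: "sm (g, y) = g + y"
  by (simp add: sm_def)

lemma pr_mem [simp]: "prG a \<in> G" "prV a \<in> V"
proof -
  have "decomp a \<in> G \<times> V"
    unfolding decomp_def using sm_bij by (metis UNIV_I bij_betw_def inv_into_into)
  then show "prG a \<in> G" "prV a \<in> V" by (auto simp: prG_def prV_def)
qed

lemma decomp_eq: "decomp a = (prG a, prV a)"
  by (simp add: prG_def prV_def)

lemma pr_add_pr [simp]: "prG a + prV a = a"
proof -
  have "sm (decomp a) = a" unfolding decomp_def using sm_bij by (simp add: bij_betw_inv_into_right)
  then show ?thesis by (simp add: decomp_eq)
qed

lemma decomp_sm: "p \<in> G \<times> V \<Longrightarrow> decomp (sm p) = p"
  unfolding decomp_def using sm_bij by (simp add: bij_betw_inv_into_left)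

lemma pr_sum [simp]:
  assumes "g \<in> G" "y \<in> V" shows "prG (g + y) = g" "prV (g + y) = y"
  using decomp_sm[of "(g, y)"] assms by (auto simp: decomp_eq)

lemma pr_components [simp]:
  "g \<in> G \<Longrightarrow> prG g = g" "g \<in> G \<Longrightarrow> prV g = 0" "y \<in> V \<Longrightarrow> prG y = 0" "y \<in> V \<Longrightarrow> prV y = y"
  using pr_sum[of g 0] pr_sum[of 0 y] by simp_all

text \<open>Splittings along \<open>G\<close> and \<open>V\<close> are unique by
  \<open>pr_sum\<close>, so it suffices to exhibit one splitting of \<open>a + b\<close>.\<close>

lemma pr_add: "prG (a + b) = prG a + prG b" "prV (a + b) = prV a + prV b"
proof -
  have "a + b = (prG a + prG b) + (prV a + prV b)"
    using pr_add_pr[of a] pr_add_pr[of b] by (metis add.left_commute add.assoc)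
  then show "prG (a + b) = prG a + prG b" "prV (a + b) = prV a + prV b"
    using pr_sum[of "prG a + prG b" "prV a + prV b"] by auto
qed

lemma pr_scale: "prG (scale c a) = scale c (prG a)" "prV (scale c a) = scale c (prV a)"
proof -
  have "scale c a = scale c (prG a) + scale c (prV a)"
    by (metis pr_add_pr scale_right_distrib)
  then show "prG (scale c a) = scale c (prG a)" "prV (scale c a) = scale c (prV a)"
    using pr_sum[of "scale c (prG a)" "scale c (prV a)"] by auto
qed

lemma sm_inj: "p \<in> G \<times> V \<Longrightarrow> q \<in> G \<times> V \<Longrightarrow> sm p = sm q \<Longrightarrow> p = q"
  using decomp_sm by metis

lemma prod_scale_pair [simp]: "prod_scale c (a, b) = (scale c a, scale c b)"
proof -
  interpret vector_space_prod scale scale by unfold_locales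
  show ?thesis by (rule scale_prod)
qed

lemma prod_vector_space: "vector_space prod_scale"
proof -
  interpret vector_space_prod scale scale by unfold_locales
  show ?thesis by (rule p.vector_space_axioms)
qed

lemma sm_linear: "linear_on prod_scale scale (G \<times> V) UNIV sm"
  by (auto simp: linear_on_def algebra_simps)

lemma decomp_linear: "linear_on scale prod_scale UNIV (G \<times> V) decomp"
  by (auto simp: linear_on_def decomp_eq pr_add pr_scale)

lemma decomp_bij: "bij_betw decomp UNIV (G \<times> V)"
  unfolding decomp_def by (rule bij_betw_inv_into[OF sm_bij])

lemma to_E_eq:
  "to_E d = (\<lambda>a b. sm (ubr d (decomp a) (decomp b)), \<lambda>a. sm (uop d (decomp a)))"
  by (simp add: transported_product_def decomp_def sm_def Let_def)

lemma ubr_pair: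
  "ubr d (g, y) (h, z) = (brg g h + lactG d y h - lactG d z g + cocyc d y z,
     brV d y z + ractV d y h - ractV d z g)"
  by (simp add: unified_bracket_def)

lemma uop_pair: "uop d (g, y) = (Pg g + opP1 d y, opP2 d y)"
  by (simp add: unified_operator_def)

section \<open>Calculation rules for extending data\<close>

lemma data_maps:
  assumes "d \<in> data"
  shows "bilinear_on scale V G V (ractV d)" "bilinear_on scale V G G (lactG d)"
    "bilinear_on scale V V G (cocyc d)" "bilinear_on scale V V V (brV d)"
    "linear_on scale scale V G (opP1 d)" "linear_on scale scale V V (opP2 d)"
  using assms by (auto simp: extending_data_def)

lemma data_mem:
  assumes "d \<in> data"
  shows "y \<in> V \<Longrightarrow> g \<in> G \<Longrightarrow> ractV d y g \<in> V" "y \<in> V \<Longrightarrow> g \<in> G \<Longrightarrow> lactG d y g \<in> G"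
    "y \<in> V \<Longrightarrow> z \<in> V \<Longrightarrow> cocyc d y z \<in> G" "y \<in> V \<Longrightarrow> z \<in> V \<Longrightarrow> brV d y z \<in> V"
    "y \<in> V \<Longrightarrow> opP1 d y \<in> G" "y \<in> V \<Longrightarrow> opP2 d y \<in> V"
  using bilinear_onD(1)[OF data_maps(1)[OF assms]] bilinear_onD(1)[OF data_maps(2)[OF assms]]
    bilinear_onD(1)[OF data_maps(3)[OF assms]] bilinear_onD(1)[OF data_maps(4)[OF assms]]
    linear_onD(1)[OF data_maps(5)[OF assms]] linear_onD(1)[OF data_maps(6)[OF assms]]
  by auto

lemma data_add:
  assumes "d \<in> data"
  shows "y \<in> V \<Longrightarrow> g \<in> G \<Longrightarrow> h \<in> G \<Longrightarrow> ractV d y (g + h) = ractV d y g + ractV d y h"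
    "y \<in> V \<Longrightarrow> g \<in> G \<Longrightarrow> h \<in> G \<Longrightarrow> lactG d y (g + h) = lactG d y g + lactG d y h"
  using bilinear_onD(3)[OF data_maps(1)[OF assms]] bilinear_onD(3)[OF data_maps(2)[OF assms]]
  by auto

lemma data_zero:
  assumes "d \<in> data"
  shows "g \<in> G \<Longrightarrow> ractV d 0 g = 0" "y \<in> V \<Longrightarrow> ractV d y 0 = 0"
    "g \<in> G \<Longrightarrow> lactG d 0 g = 0" "y \<in> V \<Longrightarrow> lactG d y 0 = 0"
    "y \<in> V \<Longrightarrow> cocyc d 0 y = 0" "y \<in> V \<Longrightarrow> cocyc d y 0 = 0"
    "y \<in> V \<Longrightarrow> brV d 0 y = 0" "y \<in> V \<Longrightarrow> brV d y 0 = 0"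
    "opP1 d 0 = 0" "opP2 d 0 = 0"
  using bilinear_on_additive(1,2)[OF data_maps(1)[OF assms] vector_space_axioms V_subspace carrier_subspace]
    bilinear_on_additive(1,2)[OF data_maps(2)[OF assms] vector_space_axioms V_subspace carrier_subspace]
    bilinear_on_additive(1,2)[OF data_maps(3)[OF assms] vector_space_axioms V_subspace V_subspace]
    bilinear_on_additive(1,2)[OF data_maps(4)[OF assms] vector_space_axioms V_subspace V_subspace]
    linear_on_additive(1)[OF data_maps(5)[OF assms] vector_space_axioms V_subspace]
    linear_on_additive(1)[OF data_maps(6)[OF assms] vector_space_axioms V_subspace]
  by auto

section \<open>Structures on E as transported unified products\<close>

lemma ubr_mem: "d \<in> data \<Longrightarrow> p \<in> G \<times> V \<Longrightarrow> q \<in> G \<times> V \<Longrightarrow> ubr d p q \<in> G \<times> V"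
  by (auto simp: ubr_pair data_mem)

lemma uop_mem: "d \<in> data \<Longrightarrow> p \<in> G \<times> V \<Longrightarrow> uop d p \<in> G \<times> V"
  by (auto simp: uop_pair data_mem)

lemma ext_structsD:
  assumes "d \<in> ext_structs"
  shows "d \<in> data" "rota_baxter_lie_algebra_on prod_scale (G \<times> V) (ubr d) lam (uop d)"
  using assms by (auto simp: extending_structures_def)

text \<open>The axioms travel along \<open>sm\<close>. On \<open>G\<close> the
  \<open>V\<close>-components are 0, which kills every term contributed by the datum and leaves
  \<open>brg\<close> and \<open>Pg\<close>.\<close>

lemma to_E_structs:
  assumes "d \<in> ext_structs" shows "to_E d \<in> structs"
proof -
  note d = ext_structsD[OF assms]
  have "rota_baxter_lie_algebra_on scale UNIV (\<lambda>a b. sm (ubr d (decomp a) (decomp b))) lam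
      (\<lambda>a. sm (uop d (decomp a)))"
    by (rule rb_lie_algebra_transport[OF d(2) vector_space_axioms sm_linear sm_bij])
      (simp_all add: decomp_sm)
  moreover have "rb_lie_subalgebra scale G brg Pg (\<lambda>a b. sm (ubr d (decomp a) (decomp b)))
      (\<lambda>a. sm (uop d (decomp a)))"
    using carrier_subspace
    by (simp add: rb_lie_subalgebra_def decomp_eq ubr_pair uop_pair data_zero[OF d(1)])
  ultimately show ?thesis by (simp add: to_E_eq rb_structures_def)
qed

text \<open>The datum consists of the components of the given structure with respect to E = G + V.
  Its unified product gives back the structure itself, not merely an equivalent one.\<close>

lemma to_E_surj:
  assumes "(br, P) \<in> structs" shows "\<exists>d\<in>ext_structs. to_E d = (br, P)"
proof -
  interpret E: rota_baxter_lie_algebra_on scale UNIV br lam P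
    using assms by (simp add: rb_structures_def)
  have sub: "\<And>g h. g \<in> G \<Longrightarrow> h \<in> G \<Longrightarrow> br g h = brg g h" "\<And>g. g \<in> G \<Longrightarrow> P g = Pg g"
    using assms by (auto simp: rb_structures_def rb_lie_subalgebra_def)
  note b = bilinear_onD(2-5)[OF E.bracket_bilinear, simplified]
  note p = linear_onD(2-3)[OF E.operator_linear, simplified]
  have antisym: "br a b = - br b a" for a b by (rule E.bracket_antisym) simp_all
  \<comment> \<open>The \<open>G\<close>-components of \<open>br y g\<close>, \<open>br y z\<close>,
    \<open>P y\<close> give the left action, the cocycle and P1; the \<open>V\<close>-components
    give the right action, the bracket on \<open>V\<close> and P2. The restrictions make the datum
    extensional, as \<open>extending_data\<close> requires.\<close>
  define d where "d = \<lparr> ractV = (\<lambda>y\<in>V. \<lambda>g\<in>G. prV (br y g)), lactG = (\<lambda>y\<in>V. \<lambda>g\<in>G. prG (br y g)),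
    cocyc = (\<lambda>y\<in>V. \<lambda>z\<in>V. prG (br y z)), brV = (\<lambda>y\<in>V. \<lambda>z\<in>V. prV (br y z)),
    opP1 = (\<lambda>y\<in>V. prG (P y)), opP2 = (\<lambda>y\<in>V. prV (P y)) \<rparr>"
  have d: "d \<in> data"
    unfolding extending_data_def d_def bilinear_on_def linear_on_def
    by (simp add: b p pr_add pr_scale)
  have ubr: "sm (ubr d q r) = br (sm q) (sm r)" if q: "q \<in> G \<times> V" and r: "r \<in> G \<times> V" for q r
  proof -
    obtain g y h z where qr: "q = (g, y)" "r = (h, z)" "g \<in> G" "y \<in> V" "h \<in> G" "z \<in> V"
      using q r by (elim SigmaE) blast
    \<comment> \<open>The mixed term \<open>br g z\<close> is rewritten as \<open>- br z g\<close>;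
      this is the source of the minus signs in the unified bracket.\<close>
    have "br (g + y) (h + z) = brg g h + br y h - br z g + br y z"
      using qr antisym[of g z] by (simp add: b sub)
    also have "\<dots> = sm (ubr d q r)"
      using pr_add_pr[of "br y h"] pr_add_pr[of "br z g"] pr_add_pr[of "br y z"]
      unfolding qr(1,2) ubr_pair
      by (simp add: qr(3-6) d_def algebra_simps)
    finally show ?thesis by (simp add: qr)
  qed
  have uop: "sm (uop d q) = P (sm q)" if "q \<in> G \<times> V" for q
    using that by (auto simp: uop_pair d_def p sub add.assoc)
  have mem: "decomp a \<in> G \<times> V" and sm_decomp: "sm (decomp a) = a" for a by (auto simp: decomp_eq)
  have "ubr d (decomp a) (decomp b) = decomp (br a b)" "uop d (decomp a) = decomp (P a)" for a b
    using ubr[OF mem mem, of a b] uop[OF mem, of a] decomp_sm[OF ubr_mem[OF d mem mem]]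
      decomp_sm[OF uop_mem[OF d mem]]
    by (metis sm_decomp)+
  \<comment> \<open>Here the axioms travel back from E to \<open>G \<times> V\<close> along
    \<open>decomp\<close>.\<close>
  then have "rota_baxter_lie_algebra_on prod_scale (G \<times> V) (ubr d) lam (uop d)"
    by (intro rb_lie_algebra_transport[OF E.rota_baxter_lie_algebra_on_axioms prod_vector_space
          decomp_linear decomp_bij])
  then have "d \<in> ext_structs" using d by (simp add: extending_structures_def)
  moreover have "to_E d = (br, P)" by (simp add: to_E_eq ubr uop mem sm_decomp)
  ultimately show ?thesis by blast
qed

section \<open>Equivalence of extending structures as isomorphism over G\<close>

definition shear :: "('e \<Rightarrow> 'e) \<Rightarrow> ('e \<Rightarrow> 'e) \<Rightarrow> 'e \<times> 'e \<Rightarrow> 'e \<times> 'e"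
  where "shear r v = (\<lambda>(g, y). (g + r y, v y))"

text \<open>A shear is the coordinate form of a linear endomorphism of E that is the identity on
  \<open>G\<close>; \<open>r\<close> and \<open>v\<close> are the components of its restriction to
  \<open>V\<close>. The condition says that this endomorphism respects brackets and
  operators.\<close>

definition intertwines :: "('e \<Rightarrow> 'e) \<Rightarrow> ('e \<Rightarrow> 'e) \<Rightarrow> 'e extending_datum \<Rightarrow> 'e extending_datum \<Rightarrow> bool"
  where "intertwines r v d d' \<longleftrightarrow>
    (\<forall>p\<in>G \<times> V. \<forall>q\<in>G \<times> V. shear r v (ubr d p q) = ubr d' (shear r v p) (shear r v q)) \<and>
    (\<forall>p\<in>G \<times> V. shear r v (uop d p) = uop d' (shear r v p))"

lemma shear_pair [simp]: "shear r v (g, y) = (g + r y, v y)"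
  by (simp add: shear_def)

lemma shear_mem:
  "linear_on scale scale V G r \<Longrightarrow> linear_on scale scale V V v \<Longrightarrow> p \<in> G \<times> V \<Longrightarrow> shear r v p \<in> G \<times> V"
  by (auto simp: linear_onD(1))

text \<open>The clauses are those defining the relation for \<open>H2\<close>, with
  \<open>v y\<close> in place of \<open>y\<close>, so no inverse of \<open>v\<close> appears. They
  arise by testing brackets on \<open>(0, y), (g, 0)\<close> and on \<open>(0, y), (0, z)\<close>,
  and the operator on \<open>(0, y)\<close>. Additivity in each argument recovers the general
  case.\<close>

lemma intertwines_iff:
  assumes d: "d \<in> data" and d': "d' \<in> data"
    and r: "linear_on scale scale V G r" and v: "linear_on scale scale V V v"
  shows "intertwines r v d d' \<longleftrightarrow> (\<forall>g\<in>G. \<forall>y\<in>V. \<forall>z\<in>V.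
    ractV d' (v y) g = v (ractV d y g) \<and>
    lactG d' (v y) g = r (ractV d y g) + lactG d y g + brg g (r y) \<and>
    cocyc d' (v y) (v z) = cocyc d y z + r (brV d y z) + brg (r y) (r z)
      - r (ractV d y (r z)) - lactG d y (r z) + r (ractV d z (r y)) + lactG d z (r y) \<and>
    brV d' (v y) (v z) = v (brV d y z) - v (ractV d y (r z)) + v (ractV d z (r y)) \<and>
    opP1 d' (v y) = opP1 d y - Pg (r y) + r (opP2 d y) \<and>
    opP2 d' (v y) = v (opP2 d y))" (is "_ \<longleftrightarrow> (\<forall>g\<in>G. \<forall>y\<in>V. \<forall>z\<in>V. ?rel g y z)")
proof -
  note mem = data_mem[OF d] data_mem[OF d'] linear_onD(1)[OF r] linear_onD(1)[OF v]
  note r_add = linear_onD(2)[OF r] linear_on_additive[OF r vector_space_axioms V_subspace]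
  note v_add = linear_onD(2)[OF v] linear_on_additive[OF v vector_space_axioms V_subspace]
  note zero = data_zero[OF d] data_zero[OF d']
  show ?thesis
  proof
    assume *: "intertwines r v d d'"
    have B: "shear r v (ubr d p q) = ubr d' (shear r v p) (shear r v q)"
      if "p \<in> G \<times> V" "q \<in> G \<times> V" for p q
      using * that unfolding intertwines_def by blast
    have O: "shear r v (uop d p) = uop d' (shear r v p)" if "p \<in> G \<times> V" for p
      using * that unfolding intertwines_def by blast
    have act: "ractV d' (v y) g = v (ractV d y g)"
        "lactG d' (v y) g = r (ractV d y g) + lactG d y g + brg g (r y)"
      if "g \<in> G" "y \<in> V" for g y
      using B[of "(0, y)" "(g, 0)"] that bracket_antisym[of "r y" g]
      by (simp_all add: ubr_pair mem zero r_add v_add bracket_simps algebra_simps)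
    show "\<forall>g\<in>G. \<forall>y\<in>V. \<forall>z\<in>V. ?rel g y z"
    proof (intro ballI)
      fix g y z assume [simp]: "g \<in> G" "y \<in> V" "z \<in> V"
      \<comment> \<open>At \<open>(0, y), (0, z)\<close> the actions of \<open>d'\<close> are
        eliminated by \<open>act\<close>. Each elimination brings in a bracket of \<open>r y\<close>
        and \<open>r z\<close>; with the one already present they collapse to
        \<open>- brg (r y) (r z)\<close>, which changes sign on the other side.\<close>
      show "?rel g y z"
        using B[of "(0, y)" "(0, z)"] O[of "(0, y)"] bracket_antisym[of "r z" "r y"]
        by (simp add: act ubr_pair uop_pair mem zero r_add v_add bracket_simps operator_simps
            algebra_simps)
    qed
  next
    assume rel: "\<forall>g\<in>G. \<forall>y\<in>V. \<forall>z\<in>V. ?rel g y z"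
    then have rels: "ractV d' (v y) g = v (ractV d y g)"
      "lactG d' (v y) g = r (ractV d y g) + lactG d y g + brg g (r y)"
      "cocyc d' (v y) (v z) = cocyc d y z + r (brV d y z) + brg (r y) (r z)
        - r (ractV d y (r z)) - lactG d y (r z) + r (ractV d z (r y)) + lactG d z (r y)"
      "brV d' (v y) (v z) = v (brV d y z) - v (ractV d y (r z)) + v (ractV d z (r y))"
      "opP1 d' (v y) = opP1 d y - Pg (r y) + r (opP2 d y)"
      "opP2 d' (v y) = v (opP2 d y)" if "g \<in> G" "y \<in> V" "z \<in> V" for g y z
      using that by blast+
    show "intertwines r v d d'"
      unfolding intertwines_def
    proof (intro conjI ballI)
      fix p q assume "p \<in> G \<times> V" "q \<in> G \<times> V"
      then obtain g y h z where pq: "p = (g, y)" "q = (h, z)"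
        and [simp]: "g \<in> G" "y \<in> V" "h \<in> G" "z \<in> V"
        by (elim SigmaE) blast
      \<comment> \<open>The clauses are quantified jointly over \<open>g\<close>, \<open>y\<close>,
        \<open>z\<close>. A variable that a clause lacks is set to 0: \<open>V_mem(1)\<close> serves
        for \<open>z\<close>, \<open>G_mem(1)\<close> for \<open>g\<close>.\<close>
      have act: "ractV d' (v y) g = v (ractV d y g)"
        "lactG d' (v y) g = r (ractV d y g) + lactG d y g + brg g (r y)"
        if "g \<in> G" "y \<in> V" for g y
        using rels(1,2)[OF that V_mem(1)] by auto
      note coc = rels(3,4)[OF G_mem(1) \<open>y \<in> V\<close> \<open>z \<in> V\<close>]
      show "shear r v (ubr d p q) = ubr d' (shear r v p) (shear r v q)"
        unfolding pq
        using bracket_antisym[of "r z" "r y"] bracket_antisym[of "r y" h]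
        by (simp add: ubr_pair act coc data_add[OF d'] mem r_add v_add bracket_simps algebra_simps)
    next
      fix p assume "p \<in> G \<times> V"
      then obtain g y where p: "p = (g, y)" and [simp]: "g \<in> G" "y \<in> V" by blast
      show "shear r v (uop d p) = uop d' (shear r v p)"
        unfolding p using rels(5,6)[OF G_mem(1) \<open>y \<in> V\<close> V_mem(1)]
        by (simp add: uop_pair mem r_add v_add operator_simps algebra_simps)
    qed
  qed
qed

text \<open>Since \<open>v\<close> permutes \<open>V\<close>, quantifying over \<open>y\<close> with
  \<open>inv_into V v y\<close> is the same as quantifying over \<open>v y\<close> with
  \<open>y\<close>; this is the substitution \<open>reindex\<close>.\<close>

lemma ext_structs_rel_iff:
  "(d, d') \<in> ext_structs_rel \<longleftrightarrow> d \<in> ext_structs \<and> d' \<in> ext_structs \<and>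
    (\<exists>r v. linear_on scale scale V G r \<and> linear_on scale scale V V v \<and> bij_betw v V V \<and>
      intertwines r v d d')"
proof -
  have reindex: "(\<forall>g\<in>G. \<forall>y\<in>V. \<forall>z\<in>V. Q g y z (inv_into V v y) (inv_into V v z)) \<longleftrightarrow>
      (\<forall>g\<in>G. \<forall>y\<in>V. \<forall>z\<in>V. Q g (v y) (v z) y z)" if v: "bij_betw v V V"
    for v and Q :: "'e \<Rightarrow> 'e \<Rightarrow> 'e \<Rightarrow> 'e \<Rightarrow> 'e \<Rightarrow> bool"
  proof -
    have V: "V = v ` V" using v by (simp add: bij_betw_def)
    have inv: "inv_into V v (v y) = y" if "y \<in> V" for y
      using v that by (simp add: bij_betw_inv_into_left)
    have all: "(\<forall>y\<in>V. R y) \<longleftrightarrow> (\<forall>y\<in>V. R (v y))" for R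
      using V by (metis (no_types, lifting) image_iff)
    show ?thesis by (subst (1 2) all) (simp add: inv)
  qed
  show ?thesis
    unfolding extending_structures_rel_def mem_Collect_eq prod.case Let_def
    by (intro conj_cong refl ex_cong1, subst reindex, assumption,
        intro intertwines_iff[symmetric]) (auto dest: ext_structsD)
qed

text \<open>As \<open>sm\<close> maps \<open>G \<times> V\<close> bijectively onto E, the morphism
  equations on E and the equations between pairs are the same statements, point by point.\<close>

lemma intertwines_iff_morphism:
  assumes d: "d \<in> data" and d': "d' \<in> data"
    and r: "linear_on scale scale V G r" and v: "linear_on scale scale V V v"
    and \<phi>: "\<And>p. p \<in> G \<times> V \<Longrightarrow> \<phi> (sm p) = sm (shear r v p)"
  shows "intertwines r v d d' \<longleftrightarrow>
    (\<forall>a b. \<phi> (fst (to_E d) a b) = fst (to_E d') (\<phi> a) (\<phi> b)) \<and>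
    (\<forall>a. \<phi> (snd (to_E d) a) = snd (to_E d') (\<phi> a))"
proof -
  have all: "(\<forall>a. R a) \<longleftrightarrow> (\<forall>p\<in>G \<times> V. R (sm p))" for R
    using sm_bij by (metis UNIV_I bij_betw_def imageE)
  note mem = shear_mem[OF r v]
  have eq: "sm p = sm q \<longleftrightarrow> p = q" if "p \<in> G \<times> V" "q \<in> G \<times> V" for p q
    using sm_inj that by blast
  have br: "\<phi> (fst (to_E d) (sm p) (sm q)) = fst (to_E d') (\<phi> (sm p)) (\<phi> (sm q)) \<longleftrightarrow>
      shear r v (ubr d p q) = ubr d' (shear r v p) (shear r v q)"
    if "p \<in> G \<times> V" "q \<in> G \<times> V" for p q
    using that by (simp add: to_E_eq decomp_sm \<phi> mem ubr_mem d d' eq del: mem_Sigma_iff)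
  have op: "\<phi> (snd (to_E d) (sm p)) = snd (to_E d') (\<phi> (sm p)) \<longleftrightarrow>
      shear r v (uop d p) = uop d' (shear r v p)"
    if "p \<in> G \<times> V" for p
    using that by (simp add: to_E_eq decomp_sm \<phi> mem uop_mem d d' eq del: mem_Sigma_iff)
  show ?thesis
    unfolding intertwines_def
    by (subst (1 2 3) all) (simp add: br op del: mem_Sigma_iff split_paired_Ball_Sigma)
qed

text \<open>An isomorphism over \<open>G\<close> is block triangular with the identity as its block
  on \<open>G\<close>, so \<phi> is bijective on E exactly when its diagonal block \<open>v\<close>
  is bijective on \<open>V\<close>.\<close>

lemma to_E_rel_iff:
  assumes d: "d \<in> ext_structs" and d': "d' \<in> ext_structs"
  shows "(d, d') \<in> ext_structs_rel \<longleftrightarrow> (to_E d, to_E d') \<in> structs_rel"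
proof -
  have rel: "(to_E d, to_E d') \<in> structs_rel \<longleftrightarrow>
    (\<exists>\<phi>. linear_on scale scale UNIV UNIV \<phi> \<and> bij \<phi> \<and> (\<forall>g\<in>G. \<phi> g = g) \<and>
      (\<forall>a b. \<phi> (fst (to_E d) a b) = fst (to_E d') (\<phi> a) (\<phi> b)) \<and>
      (\<forall>a. \<phi> (snd (to_E d) a) = snd (to_E d') (\<phi> a)))"
    using to_E_structs[OF d] to_E_structs[OF d']
    by (auto simp: rb_structures_rel_def rb_lie_isomorphism_on_def rb_lie_morphism_on_def
        split: prod.splits)
  show ?thesis
  proof
    assume "(d, d') \<in> ext_structs_rel"
    then obtain r v where r: "linear_on scale scale V G r" and v: "linear_on scale scale V V v"
      and bij: "bij_betw v V V" and rv: "intertwines r v d d'"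
      by (auto simp: ext_structs_rel_iff)
    \<comment> \<open>The shear by \<open>r\<close> and \<open>v\<close>, read on E: it sends g + y
      to g + r y + v y.\<close>
    define \<phi> where "\<phi> a = prG a + r (prV a) + v (prV a)" for a
    have \<phi>: "\<phi> (sm p) = sm (shear r v p)" if "p \<in> G \<times> V" for p
      using that by (auto simp: \<phi>_def add.assoc)
    note mem = linear_onD(1)[OF r] linear_onD(1)[OF v]
    have "linear_on scale scale UNIV UNIV \<phi>"
      by (simp add: linear_on_def \<phi>_def pr_add pr_scale linear_onD[OF r] linear_onD[OF v] algebra_simps)
    moreover have "inj \<phi>"
    proof (rule injI)
      fix a b assume "\<phi> a = \<phi> b"
      then have eq: "(prG a + r (prV a), v (prV a)) = (prG b + r (prV b), v (prV b))"
        by (intro sm_inj) (simp_all add: mem \<phi>_def)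
      then have "prV a = prV b"
        using bij pr_mem(2) by (auto simp: bij_betw_def inj_on_def)
      moreover from this have "prG a = prG b" using eq by simp
      ultimately show "a = b" by (metis pr_add_pr)
    qed
    moreover have "surj \<phi>"
    proof (rule surjI)
      fix a
      \<comment> \<open>A preimage is found by solving for the \<open>V\<close>-component first and
        then correcting the \<open>G\<close>-component by \<open>r ?y\<close>.\<close>
      let ?y = "inv_into V v (prV a)"
      have y: "?y \<in> V" "v ?y = prV a"
        using bij by (auto simp: bij_betw_def inv_into_into f_inv_into_f)
      show "\<phi> (sm (prG a - r ?y, ?y)) = a"
        using y \<phi>[of "(prG a - r ?y, ?y)"] by (simp add: mem)
    qed
    moreover have "\<forall>g\<in>G. \<phi> g = g"
      using linear_on_additive(1)[OF r vector_space_axioms V_subspace]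
        linear_on_additive(1)[OF v vector_space_axioms V_subspace] by (simp add: \<phi>_def)
    ultimately show "(to_E d, to_E d') \<in> structs_rel"
      unfolding rel bij_def
      using rv intertwines_iff_morphism[OF ext_structsD(1)[OF d] ext_structsD(1)[OF d'] r v \<phi>] by blast
  next
    assume "(to_E d, to_E d') \<in> structs_rel"
    then obtain \<phi> where lin: "linear_on scale scale UNIV UNIV \<phi>" and bij: "bij \<phi>"
      and fix_G: "\<forall>g\<in>G. \<phi> g = g"
      and mor: "(\<forall>a b. \<phi> (fst (to_E d) a b) = fst (to_E d') (\<phi> a) (\<phi> b)) \<and>
        (\<forall>a. \<phi> (snd (to_E d) a) = snd (to_E d') (\<phi> a))"
      by (auto simp: rel)
    note \<phi>_lin = linear_onD(2,3)[OF lin, simplified]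
    have \<phi>_diff: "\<phi> (a - b) = \<phi> a - \<phi> b" and \<phi>_0: "\<phi> 0 = 0" for a b
      using linear_on_additive[OF lin vector_space_axioms] by auto
    define r where "r y = prG (\<phi> y)" for y
    define v where "v y = prV (\<phi> y)" for y
    have r: "linear_on scale scale V G r" and v: "linear_on scale scale V V v"
      by (simp_all add: linear_on_def r_def v_def \<phi>_lin pr_add pr_scale)
    have \<phi>: "\<phi> (sm p) = sm (shear r v p)" if "p \<in> G \<times> V" for p
      using that fix_G by (auto simp: r_def v_def \<phi>_lin add.assoc)
    have "inj_on v V"
    proof (rule inj_onI)
      fix y z assume yz: "y \<in> V" "z \<in> V" "v y = v z"
      \<comment> \<open>Injectivity of \<open>v\<close>: \<phi> maps \<open>y - z\<close> into
        \<open>G\<close> and fixes that image. Injectivity of \<phi> then puts \<open>y - z\<close>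
        itself into \<open>G\<close>, hence into the intersection of \<open>G\<close> and
        \<open>V\<close>.\<close>
      have "prV (\<phi> (y - z)) = 0"
        using yz(3) pr_add(2)[of "\<phi> y - \<phi> z" "\<phi> z"] by (simp add: v_def \<phi>_diff)
      then have "\<phi> (y - z) \<in> G" using pr_add_pr[of "\<phi> (y - z)"] pr_mem(1) by (metis add.right_neutral)
      then have "\<phi> (\<phi> (y - z)) = \<phi> (y - z)" using fix_G by blast
      then have "y - z \<in> G" using bij \<open>\<phi> (y - z) \<in> G\<close> by (metis bij_is_inj inj_eq)
      then have "y - z = 0" using yz pr_components(2)[of "y - z"] pr_components(4)[of "y - z"] by simp
      then show "y = z" by simp
    qed
    moreover have "v ` V = V"
    proof
      show "v ` V \<subseteq> V" using linear_onD(1)[OF v] by blast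
      show "V \<subseteq> v ` V"
      proof
        fix w assume w: "w \<in> V"
        \<comment> \<open>The preimage \<open>a\<close> under \<phi> need not lie in
          \<open>V\<close>, but its \<open>V\<close>-component is a preimage of \<open>w\<close>
          under \<open>v\<close>, because \<phi> does not move \<open>G\<close> into
          \<open>V\<close>.\<close>
        obtain a where "w = \<phi> a" using bij by (metis bij_pointE)
        then have "w = \<phi> (sm (prG a, prV a))" by simp
        also have "\<dots> = sm (shear r v (prG a, prV a))" by (rule \<phi>) simp
        finally have "prV w = v (prV a)" by (simp add: linear_onD(1)[OF r] linear_onD(1)[OF v])
        then show "w \<in> v ` V" using w by simp
      qed
    qed
    ultimately have "bij_betw v V V" by (simp add: bij_betw_def)
    moreover have "intertwines r v d d'"
      using mor intertwines_iff_morphism[OF ext_structsD(1)[OF d] ext_structsD(1)[OF d'] r v \<phi>] by blast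
    ultimately show "(d, d') \<in> ext_structs_rel"
      unfolding ext_structs_rel_iff using d d' r v by blast
  qed
qed

text \<open>\<open>to_E_surj\<close> with reflexivity, and \<open>to_E_rel_iff\<close>, are the two
  hypotheses of the pullback argument along \<open>to_E\<close>.\<close>

lemma H2_bij_Extd:
  shows "equiv ext_structs ext_structs_rel"
    and "\<exists>\<Phi>. bij_betw \<Phi> (H2 scale lam G brg Pg V) (Extd scale lam G brg Pg) \<and>
      (\<forall>d\<in>ext_structs. \<Phi> (ext_structs_rel `` {d}) = structs_rel `` {to_E d})"
proof -
  have maps: "to_E \<in> ext_structs \<rightarrow> structs" using to_E_structs by blast
  have surj: "\<exists>d\<in>ext_structs. (to_E d, b) \<in> structs_rel" if b: "b \<in> structs" for b
  proof -
    obtain d where "d \<in> ext_structs" "to_E d = b"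
      using to_E_surj[of "fst b" "snd b"] b unfolding prod.collapse by blast
    with b show ?thesis
      using equiv_rb_structures_rel[of scale lam G brg Pg] by (auto simp: equiv_def refl_on_def)
  qed
  have rel: "(d, d') \<in> ext_structs_rel \<longleftrightarrow>
      d \<in> ext_structs \<and> d' \<in> ext_structs \<and> (to_E d, to_E d') \<in> structs_rel" for d d'
    using to_E_rel_iff by (auto simp: ext_structs_rel_iff)
  show "equiv ext_structs ext_structs_rel"
    and "\<exists>\<Phi>. bij_betw \<Phi> (H2 scale lam G brg Pg V) (Extd scale lam G brg Pg) \<and>
      (\<forall>d\<in>ext_structs. \<Phi> (ext_structs_rel `` {d}) = structs_rel `` {to_E d})"
    unfolding H2_def Extd_def
    using quotient_bij_pullback[OF equiv_rb_structures_rel maps surj rel] by auto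
qed

end

section \<open>Codimension one\<close>

locale rb_codim_one = rb_complement scale G brg lam Pg V
  for scale :: "'k::field \<Rightarrow> 'e::ab_group_add \<Rightarrow> 'e" and G brg lam Pg V +
  fixes x :: 'e
  assumes indep_x: "independent {x}" and span_x: "span {x} = V"
begin

abbreviation "ex_ders \<equiv> ExDer scale lam G brg Pg"
abbreviation "ex_ders_rel \<equiv> ExDer_rel scale lam G brg Pg"
abbreviation "exd \<equiv> exder_datum scale G V x"

section \<open>Coordinates on the line V\<close>

definition coord :: "'e \<Rightarrow> 'k" where "coord y = representation {x} y x"

lemma x_mem [simp]: "x \<in> V"
  using span_x span_base[of x "{x}"] by auto

lemma x_nonzero [simp]: "x \<noteq> 0"
  using indep_x dependent_zero[of "{x}"] by auto

lemma V_cases: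
  assumes "y \<in> V" obtains c where "y = scale c x"
  using assms span_x by (auto simp: span_singleton)

lemma coord_scale_x [simp]: "coord (scale c x) = c"
  using indep_x
  by (simp add: coord_def representation_scale span_base representation_basis)

lemma coord_x [simp]: "coord x = 1"
  using coord_scale_x[of 1] by simp

lemma coord_zero [simp]: "coord 0 = 0"
  using coord_scale_x[of 0] by simp

lemma scale_coord [simp]: "y \<in> V \<Longrightarrow> scale (coord y) x = y"
  by (erule V_cases) simp

lemma coord_add: "y \<in> V \<Longrightarrow> z \<in> V \<Longrightarrow> coord (y + z) = coord y + coord z"
  by (elim V_cases) (simp flip: scale_left_distrib)

lemma coord_scale: "y \<in> V \<Longrightarrow> coord (scale c y) = c * coord y"
  by (elim V_cases) simp

lemma coord_uminus: "y \<in> V \<Longrightarrow> coord (- y) = - coord y"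
  using coord_scale[of y "- 1"] by simp

lemma coord_diff: "y \<in> V \<Longrightarrow> z \<in> V \<Longrightarrow> coord (y - z) = coord y - coord z"
  using coord_add[of y "- z"] by (simp add: coord_uminus)

text \<open>The linear part of the definition of extended derivations, without the identities. This
  much makes \<open>exd\<close> an extending datum, so the identities can be compared with the
  Rota-Baxter Lie axioms in both directions.\<close>

definition quadruples :: "(('e \<Rightarrow> 'k) \<times> ('e \<Rightarrow> 'e) \<times> 'e \<times> 'k) set"
  where "quadruples = {(\<epsilon>, D, g0, k0).
    \<epsilon> \<in> G \<rightarrow>\<^sub>E UNIV \<and> linear_on scale (*) G UNIV \<epsilon> \<and>
    D \<in> G \<rightarrow>\<^sub>E G \<and> linear_on scale scale G G D \<and> g0 \<in> G}"

lemma quadruplesD: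
  assumes "(\<epsilon>, D, g0, k0) \<in> quadruples"
  shows "g \<in> G \<Longrightarrow> D g \<in> G" "g0 \<in> G"
    "g \<in> G \<Longrightarrow> h \<in> G \<Longrightarrow> D (g + h) = D g + D h"
    "g \<in> G \<Longrightarrow> h \<in> G \<Longrightarrow> D (g - h) = D g - D h"
    "g \<in> G \<Longrightarrow> D (- g) = - D g"
    "g \<in> G \<Longrightarrow> D (scale c g) = scale c (D g)" "D 0 = 0"
    "g \<in> G \<Longrightarrow> h \<in> G \<Longrightarrow> \<epsilon> (g + h) = \<epsilon> g + \<epsilon> h"
    "g \<in> G \<Longrightarrow> h \<in> G \<Longrightarrow> \<epsilon> (g - h) = \<epsilon> g - \<epsilon> h"
    "g \<in> G \<Longrightarrow> \<epsilon> (- g) = - \<epsilon> g"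
    "g \<in> G \<Longrightarrow> \<epsilon> (scale c g) = c * \<epsilon> g" "\<epsilon> 0 = 0"
proof -
  have D: "linear_on scale scale G G D" and \<epsilon>: "linear_on scale (*) G UNIV \<epsilon>" and g0: "g0 \<in> G"
    using assms by (auto simp: quadruples_def)
  note a = linear_on_additive[OF D vector_space_axioms carrier_subspace]
    and b = linear_on_additive[OF \<epsilon> vector_space_axioms carrier_subspace]
  show "g \<in> G \<Longrightarrow> D g \<in> G" "g0 \<in> G"
    "g \<in> G \<Longrightarrow> h \<in> G \<Longrightarrow> D (g + h) = D g + D h"
    "g \<in> G \<Longrightarrow> h \<in> G \<Longrightarrow> D (g - h) = D g - D h"
    "g \<in> G \<Longrightarrow> D (- g) = - D g"
    "g \<in> G \<Longrightarrow> D (scale c g) = scale c (D g)" "D 0 = 0"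
    "g \<in> G \<Longrightarrow> h \<in> G \<Longrightarrow> \<epsilon> (g + h) = \<epsilon> g + \<epsilon> h"
    "g \<in> G \<Longrightarrow> h \<in> G \<Longrightarrow> \<epsilon> (g - h) = \<epsilon> g - \<epsilon> h"
    "g \<in> G \<Longrightarrow> \<epsilon> (- g) = - \<epsilon> g"
    "g \<in> G \<Longrightarrow> \<epsilon> (scale c g) = c * \<epsilon> g" "\<epsilon> 0 = 0"
    using g0 by (simp_all add: linear_onD[OF D] linear_onD[OF \<epsilon>] a b)
qed

section \<open>The extending datum of a quadruple\<close>

lemma exd_apply:
  shows "y \<in> V \<Longrightarrow> g \<in> G \<Longrightarrow> ractV (exd (\<epsilon>, D, g0, k0)) y g = scale (coord y * \<epsilon> g) x"
    "y \<in> V \<Longrightarrow> g \<in> G \<Longrightarrow> lactG (exd (\<epsilon>, D, g0, k0)) y g = scale (coord y) (D g)"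
    "y \<in> V \<Longrightarrow> z \<in> V \<Longrightarrow> cocyc (exd (\<epsilon>, D, g0, k0)) y z = 0"
    "y \<in> V \<Longrightarrow> z \<in> V \<Longrightarrow> brV (exd (\<epsilon>, D, g0, k0)) y z = 0"
    "y \<in> V \<Longrightarrow> opP1 (exd (\<epsilon>, D, g0, k0)) y = scale (coord y) g0"
    "y \<in> V \<Longrightarrow> opP2 (exd (\<epsilon>, D, g0, k0)) y = scale (coord y * k0) x"
  by (simp_all add: exder_datum_def Let_def coord_def)

lemma exd_data:
  assumes e: "(\<epsilon>, D, g0, k0) \<in> quadruples" shows "exd (\<epsilon>, D, g0, k0) \<in> data"
  unfolding extending_data_def mem_Collect_eq
proof (intro conjI)
  note q = quadruplesD[OF e]
  show "bilinear_on scale V G V (ractV (exd (\<epsilon>, D, g0, k0)))"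
    "bilinear_on scale V G G (lactG (exd (\<epsilon>, D, g0, k0)))"
    "bilinear_on scale V V G (cocyc (exd (\<epsilon>, D, g0, k0)))"
    "bilinear_on scale V V V (brV (exd (\<epsilon>, D, g0, k0)))"
    by (rule bilinear_onI; simp add: exd_apply q coord_add coord_scale algebra_simps)+
  show "linear_on scale scale V G (opP1 (exd (\<epsilon>, D, g0, k0)))"
    "linear_on scale scale V V (opP2 (exd (\<epsilon>, D, g0, k0)))"
    by (simp_all add: linear_on_def exd_apply q coord_add coord_scale algebra_simps)
  show "ractV (exd (\<epsilon>, D, g0, k0)) \<in> V \<rightarrow>\<^sub>E G \<rightarrow>\<^sub>E V" "lactG (exd (\<epsilon>, D, g0, k0)) \<in> V \<rightarrow>\<^sub>E G \<rightarrow>\<^sub>E G"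
    "cocyc (exd (\<epsilon>, D, g0, k0)) \<in> V \<rightarrow>\<^sub>E V \<rightarrow>\<^sub>E G" "brV (exd (\<epsilon>, D, g0, k0)) \<in> V \<rightarrow>\<^sub>E V \<rightarrow>\<^sub>E V"
    "opP1 (exd (\<epsilon>, D, g0, k0)) \<in> V \<rightarrow>\<^sub>E G" "opP2 (exd (\<epsilon>, D, g0, k0)) \<in> V \<rightarrow>\<^sub>E V"
    using q by (auto simp: exder_datum_def Let_def)
qed

lemma ubr_exd:
  assumes "(\<epsilon>, D, g0, k0) \<in> quadruples" "g \<in> G" "h \<in> G"
  shows "ubr (exd (\<epsilon>, D, g0, k0)) (g, scale a x) (h, scale b x) =
    (brg g h + scale a (D h) - scale b (D g), scale (a * \<epsilon> h - b * \<epsilon> g) x)"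
  using assms(2,3) by (simp add: ubr_pair exd_apply scale_left_diff_distrib)

lemma uop_exd:
  "uop (exd (\<epsilon>, D, g0, k0)) (g, scale a x) = (Pg g + scale a g0, scale (a * k0) x)"
  by (simp add: uop_pair exd_apply)

lemma ubr_bilinear:
  assumes d: "d \<in> data" shows "bilinear_on prod_scale (G \<times> V) (G \<times> V) (G \<times> V) (ubr d)"
proof -
  note b = bilinear_onD(2-5)[OF data_maps(1)[OF d]] bilinear_onD(2-5)[OF data_maps(2)[OF d]]
    bilinear_onD(2-5)[OF data_maps(3)[OF d]] bilinear_onD(2-5)[OF data_maps(4)[OF d]]
  show ?thesis
    by (rule bilinear_onI; elim SigmaE; simp add: ubr_pair data_mem[OF d] b bracket_simps algebra_simps)
qed

lemma uop_linear:
  assumes d: "d \<in> data" shows "linear_on prod_scale prod_scale (G \<times> V) (G \<times> V) (uop d)"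
  using linear_onD(2,3)[OF data_maps(5)[OF d]] linear_onD(2,3)[OF data_maps(6)[OF d]]
  by (auto simp: linear_on_def uop_pair data_mem[OF d] operator_simps algebra_simps)

section \<open>Axioms of extended derivations and axioms of the unified product\<close>

lemma ExDer_quadruple: "e \<in> ex_ders \<Longrightarrow> e \<in> quadruples"
  by (auto simp: ExDer_def quadruples_def)

lemma ExDer_iff:
  "(\<epsilon>, D, g0, k0) \<in> ex_ders \<longleftrightarrow> (\<epsilon>, D, g0, k0) \<in> quadruples \<and>
    (\<forall>g\<in>G. \<forall>h\<in>G. \<epsilon> (brg g h) = 0) \<and>
    (\<forall>g\<in>G. \<forall>h\<in>G. D (brg g h) = brg (D g) h + brg g (D h) + scale (\<epsilon> g) (D h) - scale (\<epsilon> h) (D g)) \<and>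
    (\<forall>g\<in>G. brg (Pg g) g0 - scale k0 (D (Pg g)) + Pg (D (Pg g)) + scale (\<epsilon> (Pg g)) g0
      - Pg (brg g g0) + Pg (scale k0 (D g)) + scale (k0 * \<epsilon> g) g0
      + scale lam (Pg (D g)) + scale (lam * \<epsilon> g) g0 = 0) \<and>
    (\<forall>g\<in>G. k0\<^sup>2 * \<epsilon> g + lam * k0 * \<epsilon> g = 0)"
  by (auto simp: ExDer_def quadruples_def)

text \<open>The vanishing of \<epsilon> on brackets and the twisted derivation law, with Jacobi in
  \<open>G\<close>, yield Jacobi for general elements \<open>(g, scale a x)\<close>. The last two
  axioms, with the Rota-Baxter law in \<open>G\<close>, yield the Rota-Baxter law there. Each axiom
  is first solved for one term, to serve as a rewrite rule.\<close>

lemma exd_ext_structs: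
  assumes e: "(\<epsilon>, D, g0, k0) \<in> ex_ders" shows "exd (\<epsilon>, D, g0, k0) \<in> ext_structs"
proof -
  have q: "(\<epsilon>, D, g0, k0) \<in> quadruples" using ExDer_quadruple[OF e] .
  note data = exd_data[OF q] and qs = quadruplesD[OF q] and ubr = ubr_exd[OF q] and uop = uop_exd
  have \<epsilon>_br: "\<epsilon> (brg g h) = 0" if "g \<in> G" "h \<in> G" for g h
    using e that unfolding ExDer_iff by blast
  \<comment> \<open>Values of \<open>D\<close> are moved to the right slot of the bracket, a normal
    form in which antisymmetric terms cancel.\<close>
  have D_br: "D (brg g h) = brg g (D h) - brg h (D g) + scale (\<epsilon> g) (D h) - scale (\<epsilon> h) (D g)"
    if "g \<in> G" "h \<in> G" for g h
  proof -
    have "D (brg g h) = brg (D g) h + brg g (D h) + scale (\<epsilon> g) (D h) - scale (\<epsilon> h) (D g)"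
      using e that unfolding ExDer_iff by blast
    then show ?thesis using that bracket_antisym[of "D g" h] by (simp add: qs)
  qed
  have op: "brg (Pg g) g0 = scale k0 (D (Pg g)) - Pg (D (Pg g)) - scale (\<epsilon> (Pg g)) g0
      + Pg (brg g g0) - scale k0 (Pg (D g)) - scale (k0 * \<epsilon> g) g0
      - scale lam (Pg (D g)) - scale (lam * \<epsilon> g) g0" if "g \<in> G" for g
  proof -
    have "brg (Pg g) g0 - scale k0 (D (Pg g)) + Pg (D (Pg g)) + scale (\<epsilon> (Pg g)) g0
      - Pg (brg g g0) + Pg (scale k0 (D g)) + scale (k0 * \<epsilon> g) g0
      + scale lam (Pg (D g)) + scale (lam * \<epsilon> g) g0 = 0"
      using e that unfolding ExDer_iff by blast
    then show ?thesis using that by (simp add: qs operator_simps algebra_simps)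
  qed
  have quad: "k0 * (k0 * \<epsilon> g) = - (k0 * (lam * \<epsilon> g))" if "g \<in> G" for g
  proof -
    have "k0\<^sup>2 * \<epsilon> g + lam * k0 * \<epsilon> g = 0" using e that unfolding ExDer_iff by blast
    then show ?thesis by (simp add: power2_eq_square eq_neg_iff_add_eq_0 ac_simps)
  qed
  interpret pr: vector_space prod_scale by (rule prod_vector_space)
  have "rota_baxter_lie_algebra_on prod_scale (G \<times> V) (ubr (exd (\<epsilon>, D, g0, k0))) lam
    (uop (exd (\<epsilon>, D, g0, k0)))"
  proof (unfold_locales, goal_cases)
    case 1
    show ?case unfolding pr.subspace_def by (auto simp: zero_prod_def)
  next
    case 2
    show ?case by (rule ubr_bilinear[OF data])
  next
    case (3 p)
    then obtain g a where "p = (g, scale a x)" "g \<in> G" by (auto elim: V_cases)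
    then show ?case by (simp add: ubr bracket_alternating zero_prod_def)
  next
    case (4 p q r)
    then obtain g a h b k c where pqr: "p = (g, scale a x)" "q = (h, scale b x)" "r = (k, scale c x)"
      and [simp]: "g \<in> G" "h \<in> G" "k \<in> G" by (elim SigmaE V_cases) blast
    \<comment> \<open>The nested brackets are evaluated first, while each second component is still
      a single multiple of \<open>x\<close>; only then are the axioms used and the terms
      expanded.\<close>
    show ?case
      unfolding pqr
      using jacobi[of g h k]
      by (simp add: ubr qs, simp add: qs D_br \<epsilon>_br bracket_simps zero_prod_def algebra_simps)
  next
    case 5
    show ?case by (rule uop_linear[OF data])
  next
    case (6 p q)
    then obtain g a h b where pq: "p = (g, scale a x)" "q = (h, scale b x)"
      and [simp]: "g \<in> G" "h \<in> G" by (elim SigmaE V_cases) blast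
    \<comment> \<open>Brackets with \<open>g0\<close> are turned so that \<open>g0\<close> stands on
      the right, as in \<open>op\<close>.\<close>
    note anti = bracket_antisym[OF qs(2) \<open>h \<in> G\<close>]
      bracket_antisym[OF qs(2) G_mem(7)[OF \<open>h \<in> G\<close>]]
    \<comment> \<open>Multiples of \<open>x\<close> are first merged into one, so that
      \<open>uop\<close> applies to the argument of the operator; \<open>op\<close> and
      \<open>quad\<close> are used after that.\<close>
    show ?case
      unfolding pq
      by (simp add: ubr uop qs flip: scale_left_distrib,
          simp add: qs anti op quad rota_baxter bracket_alternating bracket_simps operator_simps
            algebra_simps)
  qed
  with data show ?thesis by (simp add: extending_structures_def)
qed

text \<open>Jacobi at \<open>(0, x), (g, 0), (h, 0)\<close> gives the derivation law in its
  \<open>G\<close>-component; in the \<open>V\<close>-component the products of \<epsilon> g and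
  \<epsilon> h cancel and leave the vanishing of \<epsilon> on brackets. The Rota-Baxter law at
  \<open>(g, 0), (0, x)\<close> gives the other two axioms in the same way.\<close>

lemma ex_ders_of_ext_structs:
  assumes e: "(\<epsilon>, D, g0, k0) \<in> quadruples" and d: "exd (\<epsilon>, D, g0, k0) \<in> ext_structs"
  shows "(\<epsilon>, D, g0, k0) \<in> ex_ders"
proof -
  let ?d = "exd (\<epsilon>, D, g0, k0)"
  note q = quadruplesD[OF e] and zero = data_zero[OF exd_data[OF e]]
  note compute = ubr_pair uop_pair exd_apply zero q coord_add coord_diff coord_uminus coord_scale
  interpret U: rota_baxter_lie_algebra_on prod_scale "G \<times> V" "ubr ?d" lam "uop ?d"
    by (rule ext_structsD(2)[OF d])
  have jac: "\<epsilon> (brg g h) = 0 \<and>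
      D (brg g h) = brg (D g) h + brg g (D h) + scale (\<epsilon> g) (D h) - scale (\<epsilon> h) (D g)"
    if gh: "g \<in> G" "h \<in> G" for g h
  proof -
    have "ubr ?d (0, x) (ubr ?d (g, 0) (h, 0)) + ubr ?d (g, 0) (ubr ?d (h, 0) (0, x)) +
        ubr ?d (h, 0) (ubr ?d (0, x) (g, 0)) = 0"
      using gh by (intro U.jacobi) auto
    then show ?thesis
      using gh bracket_antisym[of h "D g"]
      by (simp add: compute bracket_simps operator_simps zero_prod_def algebra_simps)
  qed
  have rb: "brg (Pg g) g0 - scale k0 (D (Pg g)) + Pg (D (Pg g)) + scale (\<epsilon> (Pg g)) g0
      - Pg (brg g g0) + Pg (scale k0 (D g)) + scale (k0 * \<epsilon> g) g0
      + scale lam (Pg (D g)) + scale (lam * \<epsilon> g) g0 = 0 \<and> k0\<^sup>2 * \<epsilon> g + lam * k0 * \<epsilon> g = 0"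
    if g: "g \<in> G" for g
  proof -
    have "ubr ?d (uop ?d (g, 0)) (uop ?d (0, x)) = uop ?d (ubr ?d (uop ?d (g, 0)) (0, x) +
        ubr ?d (g, 0) (uop ?d (0, x)) + prod_scale lam (ubr ?d (g, 0) (0, x)))"
      using g by (intro U.rota_baxter) auto
    then have "brg (Pg g) g0 - scale k0 (D (Pg g)) + Pg (D (Pg g)) + scale (\<epsilon> (Pg g)) g0
      - Pg (brg g g0) + Pg (scale k0 (D g)) + scale (k0 * \<epsilon> g) g0
      + scale lam (Pg (D g)) + scale (lam * \<epsilon> g) g0 = 0 \<and>
      scale (k0\<^sup>2 * \<epsilon> g + lam * k0 * \<epsilon> g) x = 0"
      using g
      by (simp add: compute bracket_simps operator_simps power2_eq_square algebra_simps)
    \<comment> \<open>The second equation lies in \<open>V\<close>; its coefficient vanishes because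
      \<open>x\<close> is nonzero.\<close>
    then show ?thesis by simp
  qed
  show ?thesis unfolding ExDer_iff using e jac rb by blast
qed

text \<open>The alternating law at \<open>(0, x)\<close> makes the cocycle and the bracket on
  \<open>V\<close> vanish at \<open>x, x\<close>, hence on the whole line. The other maps are
  determined by their values at \<open>x\<close>, which form the quadruple; extensionality then
  gives equality of data.\<close>

lemma exd_surj:
  assumes d: "d \<in> ext_structs" shows "\<exists>e\<in>ex_ders. exd e = d"
proof -
  note data = ext_structsD(1)[OF d]
  interpret U: rota_baxter_lie_algebra_on prod_scale "G \<times> V" "ubr d" lam "uop d"
    by (rule ext_structsD(2)[OF d])
  note maps = data_maps[OF data] and mem = data_mem[OF data] and zero = data_zero[OF data]
  have "ubr d (0, x) (0, x) = 0" by (rule U.bracket_alternating) simp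
  then have xx: "cocyc d x x = 0" "brV d x x = 0"
    by (simp_all add: ubr_pair zero bracket_simps zero_prod_def)
  have PiE: "ractV d \<in> V \<rightarrow>\<^sub>E G \<rightarrow>\<^sub>E V" "lactG d \<in> V \<rightarrow>\<^sub>E G \<rightarrow>\<^sub>E G" "cocyc d \<in> V \<rightarrow>\<^sub>E V \<rightarrow>\<^sub>E G"
    "brV d \<in> V \<rightarrow>\<^sub>E V \<rightarrow>\<^sub>E V" "opP1 d \<in> V \<rightarrow>\<^sub>E G" "opP2 d \<in> V \<rightarrow>\<^sub>E V"
    using data by (auto simp: extending_data_def)
  \<comment> \<open>\<open>ractV d x g\<close> lies on the line \<open>V\<close>, so it is a
    multiple of \<open>x\<close>, and \<epsilon> g is the factor.\<close>
  define \<epsilon> where "\<epsilon> = (\<lambda>g\<in>G. coord (ractV d x g))"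
  define D where "D = (\<lambda>g\<in>G. lactG d x g)"
  define g0 where "g0 = opP1 d x"
  define k0 where "k0 = coord (opP2 d x)"
  have e: "(\<epsilon>, D, g0, k0) \<in> quadruples"
    using bilinear_onD[OF maps(1)] bilinear_onD[OF maps(2)]
    by (simp add: quadruples_def linear_on_def \<epsilon>_def D_def g0_def mem coord_add coord_scale)
  note edata = exd_data[OF e]
  have ePiE: "ractV (exd (\<epsilon>, D, g0, k0)) \<in> V \<rightarrow>\<^sub>E G \<rightarrow>\<^sub>E V" "lactG (exd (\<epsilon>, D, g0, k0)) \<in> V \<rightarrow>\<^sub>E G \<rightarrow>\<^sub>E G"
    "cocyc (exd (\<epsilon>, D, g0, k0)) \<in> V \<rightarrow>\<^sub>E V \<rightarrow>\<^sub>E G" "brV (exd (\<epsilon>, D, g0, k0)) \<in> V \<rightarrow>\<^sub>E V \<rightarrow>\<^sub>E V"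
    "opP1 (exd (\<epsilon>, D, g0, k0)) \<in> V \<rightarrow>\<^sub>E G" "opP2 (exd (\<epsilon>, D, g0, k0)) \<in> V \<rightarrow>\<^sub>E V"
    using edata by (auto simp: extending_data_def)
  have ext2: "f = f'" if f: "f \<in> A \<rightarrow>\<^sub>E B \<rightarrow>\<^sub>E C" and f': "f' \<in> A \<rightarrow>\<^sub>E B \<rightarrow>\<^sub>E C"
    and eq: "\<And>a b. a \<in> A \<Longrightarrow> b \<in> B \<Longrightarrow> f a b = f' a b"
    for f f' :: "'e \<Rightarrow> 'e \<Rightarrow> 'e" and A B C
    by (rule PiE_ext[OF f f'], rule PiE_ext[OF PiE_mem[OF f] PiE_mem[OF f']]) (auto simp: eq)
  have "exd (\<epsilon>, D, g0, k0) = d"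
  proof (rule extending_datum.equality)
    show "ractV (exd (\<epsilon>, D, g0, k0)) = ractV d"
    proof (rule ext2[OF ePiE(1) PiE(1)])
      fix y g assume y: "y \<in> V" and g: "g \<in> G"
      have "scale (coord (ractV d x g)) x = ractV d x g" using g by (simp add: mem)
      then have "scale (coord y * coord (ractV d x g)) x = scale (coord y) (ractV d x g)"
        by (simp flip: scale_scale)
      also have "\<dots> = ractV d (scale (coord y) x) g"
        using bilinear_onD(4)[OF maps(1)] g by simp
      finally show "ractV (exd (\<epsilon>, D, g0, k0)) y g = ractV d y g"
        using y g by (simp add: exd_apply \<epsilon>_def)
    qed
    show "lactG (exd (\<epsilon>, D, g0, k0)) = lactG d"
      using bilinear_onD(4)[OF maps(2), symmetric]
      by (intro ext2[OF ePiE(2) PiE(2)]) (simp add: exd_apply D_def)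
    show "cocyc (exd (\<epsilon>, D, g0, k0)) = cocyc d"
      by (intro ext2[OF ePiE(3) PiE(3)])
        (auto simp: exd_apply bilinear_onD[OF maps(3)] xx elim!: V_cases)
    show "brV (exd (\<epsilon>, D, g0, k0)) = brV d"
      by (intro ext2[OF ePiE(4) PiE(4)])
        (auto simp: exd_apply bilinear_onD[OF maps(4)] xx elim!: V_cases)
    show "opP1 (exd (\<epsilon>, D, g0, k0)) = opP1 d"
      using linear_onD(3)[OF maps(5), symmetric]
      by (intro PiE_ext[OF ePiE(5) PiE(5)]) (simp add: exd_apply g0_def)
    show "opP2 (exd (\<epsilon>, D, g0, k0)) = opP2 d"
    proof (rule PiE_ext[OF ePiE(6) PiE(6)])
      fix y assume y: "y \<in> V"
      have "scale (coord (opP2 d x)) x = opP2 d x" by (simp add: mem)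
      then have "scale (coord y * coord (opP2 d x)) x = scale (coord y) (opP2 d x)"
        by (simp flip: scale_scale)
      also have "\<dots> = opP2 d (scale (coord y) x)"
        using linear_onD(3)[OF maps(6)] by simp
      finally show "opP2 (exd (\<epsilon>, D, g0, k0)) y = opP2 d y"
        using y by (simp add: exd_apply k0_def)
    qed
  qed simp
  moreover from this have "(\<epsilon>, D, g0, k0) \<in> ex_ders"
    using ex_ders_of_ext_structs[OF e] d by simp
  ultimately show ?thesis by blast
qed

text \<open>On a line, \<open>r\<close> amounts to the vector g1 = r x, and an automorphism
  \<open>v\<close> to a nonzero scalar k1 with v x = k1 x. The clauses for the actions and operators
  at \<open>x\<close> are then the conditions on the two quadruples.\<close>

lemma ex_ders_rel_iff:
  "(e, e') \<in> ex_ders_rel \<longleftrightarrow> e \<in> ex_ders \<and> e' \<in> ex_ders \<and> (exd e, exd e') \<in> ext_structs_rel"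
proof -
  obtain \<epsilon> D g0 k0 \<epsilon>' D' g0' k0' where ee': "e = (\<epsilon>, D, g0, k0)" "e' = (\<epsilon>', D', g0', k0')"
    by (metis prod_cases4)
  have "(e, e') \<in> ex_ders_rel \<longleftrightarrow> (exd e, exd e') \<in> ext_structs_rel"
    if e: "e \<in> ex_ders" and e': "e' \<in> ex_ders"
  proof -
    have quad: "(\<epsilon>, D, g0, k0) \<in> quadruples" "(\<epsilon>', D', g0', k0') \<in> quadruples"
      using ExDer_quadruple e e' unfolding ee' by blast+
    note q = quadruplesD[OF quad(1)] and q' = quadruplesD[OF quad(2)]
    note data = exd_data[OF quad(1)] exd_data[OF quad(2)]
    have structs: "exd e \<in> ext_structs" "exd e' \<in> ext_structs"
      using exd_ext_structs e e' unfolding ee' by blast+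
    show ?thesis
    proof
      assume "(e, e') \<in> ex_ders_rel"
      then obtain g1 k1 where "\<epsilon> = \<epsilon>'" "k0 = k0'" and g1: "g1 \<in> G" and k1: "k1 \<noteq> 0"
        and D: "\<And>g. g \<in> G \<Longrightarrow> D g = scale k1 (D' g) + brg g1 g - scale (\<epsilon> g) g1"
        and g0: "g0 = Pg g1 + scale k1 g0' - scale k0 g1"
        unfolding ee' ExDer_rel_def by blast
      \<comment> \<open>The linear map with value \<open>g1\<close> at \<open>x\<close>; its partner
        \<open>v\<close> is multiplication by \<open>k1\<close>.\<close>
      define r where "r y = scale (coord y) g1" for y
      have r: "linear_on scale scale V G r"
        using g1 by (simp add: linear_on_def r_def coord_add coord_scale scale_left_distrib)
      have v: "linear_on scale scale V V (scale k1)"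
        by (simp add: linear_on_def algebra_simps)
      have bij: "bij_betw (scale k1) V V"
        by (rule bij_betw_byWitness[where f' = "scale (inverse k1)"]) (use k1 in auto)
      have "intertwines r (scale k1) (exd e) (exd e')"
        unfolding ee' intertwines_iff[OF data r v]
      proof (intro ballI)
        fix g y z assume g: "g \<in> G" and "y \<in> V" "z \<in> V"
        then obtain a b where yz: "y = scale a x" "z = scale b x" by (elim V_cases) blast
        note anti = bracket_antisym[OF g1 g]
        \<comment> \<open>In the clauses for cocycle and bracket all terms vanish or cancel:
          \<open>y\<close> and \<open>z\<close> are multiples of \<open>x\<close>, so the
          corrections pair off with opposite signs, and \<open>brg g1 g1\<close> is 0.\<close>
        show "ractV (exd (\<epsilon>', D', g0', k0')) (scale k1 y) g = scale k1 (ractV (exd (\<epsilon>, D, g0, k0)) y g) \<and>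
          lactG (exd (\<epsilon>', D', g0', k0')) (scale k1 y) g =
            r (ractV (exd (\<epsilon>, D, g0, k0)) y g) + lactG (exd (\<epsilon>, D, g0, k0)) y g + brg g (r y) \<and>
          cocyc (exd (\<epsilon>', D', g0', k0')) (scale k1 y) (scale k1 z) =
            cocyc (exd (\<epsilon>, D, g0, k0)) y z + r (brV (exd (\<epsilon>, D, g0, k0)) y z) + brg (r y) (r z)
            - r (ractV (exd (\<epsilon>, D, g0, k0)) y (r z)) - lactG (exd (\<epsilon>, D, g0, k0)) y (r z)
            + r (ractV (exd (\<epsilon>, D, g0, k0)) z (r y)) + lactG (exd (\<epsilon>, D, g0, k0)) z (r y) \<and>
          brV (exd (\<epsilon>', D', g0', k0')) (scale k1 y) (scale k1 z) =
            scale k1 (brV (exd (\<epsilon>, D, g0, k0)) y z) - scale k1 (ractV (exd (\<epsilon>, D, g0, k0)) y (r z))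
            + scale k1 (ractV (exd (\<epsilon>, D, g0, k0)) z (r y)) \<and>
          opP1 (exd (\<epsilon>', D', g0', k0')) (scale k1 y) =
            opP1 (exd (\<epsilon>, D, g0, k0)) y - Pg (r y) + r (opP2 (exd (\<epsilon>, D, g0, k0)) y) \<and>
          opP2 (exd (\<epsilon>', D', g0', k0')) (scale k1 y) = scale k1 (opP2 (exd (\<epsilon>, D, g0, k0)) y)"
          unfolding yz \<open>\<epsilon> = \<epsilon>'\<close>[symmetric] \<open>k0 = k0'\<close>[symmetric]
          using g g1
          by (simp add: exd_apply q q' r_def g0 D anti bracket_alternating bracket_simps
              operator_simps algebra_simps)
      qed
      then show "(exd e, exd e') \<in> ext_structs_rel"
        unfolding ext_structs_rel_iff using structs r v bij by blast
    next
      assume "(exd e, exd e') \<in> ext_structs_rel"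
      then obtain r v where r: "linear_on scale scale V G r" and v: "linear_on scale scale V V v"
        and bij: "bij_betw v V V" and rv: "intertwines r v (exd e) (exd e')"
        unfolding ext_structs_rel_iff by blast
      define g1 where "g1 = r x"
      define k1 where "k1 = coord (v x)"
      have g1: "g1 \<in> G" using linear_onD(1)[OF r] by (simp add: g1_def)
      have vx: "v x = scale k1 x" using linear_onD(1)[OF v] by (simp add: k1_def)
      have k1: "k1 \<noteq> 0"
      proof
        assume "k1 = 0"
        then have "v x = v 0" using vx linear_on_additive(1)[OF v vector_space_axioms V_subspace] by simp
        then show False using bij by (simp add: bij_betw_def inj_on_def) (metis V_mem(1) x_mem x_nonzero)
      qed
      have r_x: "r (scale c x) = scale c g1" and v_x: "v (scale c x) = scale (c * k1) x" for c
        using linear_onD(3)[OF r, of x c] linear_onD(3)[OF v, of x c] by (simp_all add: g1_def vx)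
      have rels: "\<epsilon> g = \<epsilon>' g \<and> scale k1 (D' g) = scale (\<epsilon> g) g1 + D g + brg g g1 \<and>
          scale k1 g0' = g0 - Pg g1 + scale k0 g1 \<and> k0 = k0'" if g: "g \<in> G" for g
      proof -
        have "ractV (exd e') (v x) g = v (ractV (exd e) x g)"
          "lactG (exd e') (v x) g = r (ractV (exd e) x g) + lactG (exd e) x g + brg g (r x)"
          "opP1 (exd e') (v x) = opP1 (exd e) x - Pg (r x) + r (opP2 (exd e) x)"
          "opP2 (exd e') (v x) = v (opP2 (exd e) x)"
          using rv[unfolded ee' intertwines_iff[OF data r v]] g x_mem unfolding ee' by blast+
        then show ?thesis
          unfolding ee' using g k1
          by (simp add: exd_apply vx r_x v_x g1_def[symmetric] ac_simps)
      qed
      \<comment> \<open>The relation demands equality of functions on the whole type; agreement on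
        \<open>G\<close> suffices since both are extensional there.\<close>
      have "\<epsilon> = \<epsilon>'"
        using quad rels by (intro PiE_ext[of \<epsilon> G "\<lambda>_. UNIV" \<epsilon>']) (auto simp: quadruples_def)
      moreover have "D g = scale k1 (D' g) + brg g1 g - scale (\<epsilon> g) g1" if "g \<in> G" for g
        using rels[OF that] bracket_antisym[OF g1 that] by simp
      \<comment> \<open>The conditions on \<open>g0\<close> and \<open>k0\<close> do not mention
        \<open>g\<close> and are read off from the instance g = 0.\<close>
      ultimately show "(e, e') \<in> ex_ders_rel"
        unfolding ee' ExDer_rel_def mem_Collect_eq prod.case
        using e e' rels[OF G_mem(1)] g1 k1 unfolding ee' by (auto intro!: bexI[of _ g1] exI[of _ k1])
    qed
  qed
  moreover have "e \<in> ex_ders \<and> e' \<in> ex_ders" if "(e, e') \<in> ex_ders_rel"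
    using that unfolding ee' ExDer_rel_def by blast
  ultimately show ?thesis by blast
qed

text \<open>The pullback argument again, now along \<open>exd\<close> and over the relation on
  extending structures; it also proves that \<equiv> on extended derivations is an equivalence
  relation.\<close>

lemma ExDer_bij_H2:
  shows "equiv ex_ders ex_ders_rel"
    and "\<exists>\<Psi>. bij_betw \<Psi> (ex_ders // ex_ders_rel) (H2 scale lam G brg Pg V) \<and>
      (\<forall>e\<in>ex_ders. \<Psi> (ex_ders_rel `` {e}) = ext_structs_rel `` {exd e})"
proof -
  have maps: "exd \<in> ex_ders \<rightarrow> ext_structs"
    using exd_ext_structs by (auto intro!: funcsetI)
  have surj: "\<exists>e\<in>ex_ders. (exd e, d) \<in> ext_structs_rel" if "d \<in> ext_structs" for d
    using exd_surj[OF that] that H2_bij_Extd(1) by (auto simp: equiv_def refl_on_def)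
  show "equiv ex_ders ex_ders_rel"
    and "\<exists>\<Psi>. bij_betw \<Psi> (ex_ders // ex_ders_rel) (H2 scale lam G brg Pg V) \<and>
      (\<forall>e\<in>ex_ders. \<Psi> (ex_ders_rel `` {e}) = ext_structs_rel `` {exd e})"
    unfolding H2_def
    using quotient_bij_pullback[OF H2_bij_Extd(1) maps surj ex_ders_rel_iff] by auto
qed

end

theorem theorem4p7:
  fixes scale :: "'k::field \<Rightarrow> 'e::ab_group_add \<Rightarrow> 'e" and lam :: 'k
    and G V :: "'e set" and brg :: "'e \<Rightarrow> 'e \<Rightarrow> 'e" and Pg :: "'e \<Rightarrow> 'e" and x :: 'e
  assumes "vector_space scale"
    and "rota_baxter_lie_algebra_on scale G brg lam Pg"
    and "complement_of scale G V"
    and "\<not> module.dependent scale {x}" and "module.span scale {x} = V"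
  shows "equiv (ExDer scale lam G brg Pg) (ExDer_rel scale lam G brg Pg) \<and>
    (\<exists>\<Phi>. bij_betw \<Phi> (H2 scale lam G brg Pg V) (Extd scale lam G brg Pg) \<and>
      (\<forall>d \<in> extending_structures scale lam G brg Pg V.
        transported_product G brg Pg V d \<in> rb_structures scale lam G brg Pg \<and>
        \<Phi> (extending_structures_rel scale lam G brg Pg V `` {d}) =
          rb_structures_rel scale lam G brg Pg `` {transported_product G brg Pg V d})) \<and>
    (\<exists>\<Psi>. bij_betw \<Psi> (ExDer scale lam G brg Pg // ExDer_rel scale lam G brg Pg)
        (H2 scale lam G brg Pg V) \<and>
      (\<forall>e \<in> ExDer scale lam G brg Pg.
        exder_datum scale G V x e \<in> extending_structures scale lam G brg Pg V \<and>
        \<Psi> (ExDer_rel scale lam G brg Pg `` {e}) =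
          extending_structures_rel scale lam G brg Pg V `` {exder_datum scale G V x e}))"
proof -
  interpret rota_baxter_lie_algebra_on scale G brg lam Pg by fact
  interpret rb_codim_one scale G brg lam Pg V x by unfold_locales fact+
  have "exd e \<in> ext_structs" if "e \<in> ex_ders" for e
    using that exd_ext_structs by (cases e) blast
  then show ?thesis
    using ExDer_bij_H2 H2_bij_Extd(2) to_E_structs by auto
qed

end
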